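(* Let $q=p^m$ with $m=5s$, $s\in\mathbb{N}$ (so $q=p^{5s}$), and $p$ a prime with $p\equiv1\pmod5$, and put $n=\frac{q-1}{5}$. Then $$\mathrm{Spec}(\Gamma(5,q))=\big\{[n]^1,[\tfrac{\eta_0^*-1}5]^n,[\tfrac{\eta_1^*-1}5]^n,[\tfrac{\eta_2^*-1}5]^n,[\tfrac{\eta_3^*-1}5]^n,[\tfrac{\eta_4^*-1}5]^n\big\},$$ where $$\eta_0^*=-\tfrac1{16}p^s(x^3-25L)\qquad\text{and}\qquad \eta_{i+1}^*=\tfrac1{64}p^s(x^3-25M)^{\sigma^i}\quad(0\le i\le3),$$ with $\sigma$ the non-singular linear transformation of order $4$ given by $\sigma(x,w,v,u)=(x,-w,-u,v)$, where $f^{\sigma^i}$ denotes the value of the polynomial expression $f$ at $\sigma^i(x,w,v,u)$, and $$L=2x(v^2+u^2)+5w(11v^2-4vu-11u^2),$$ $$\begin{aligned}M={}&2x^2u+7xv^2+20xvu-3xu^2+125w^3+200w^2v-150w^2u+5wv^2\\&-20wvu-105wu^2-40v^3-60v^2u+120vu^2+20u^3,\end{aligned}$$ for $(x,w,v,u)$ any integer solution of the system $$16p^{m}=x^2+125w^2+50v^2+50u^2,\qquad xw=v^2-4uv-u^2,\qquad x\equiv-1\pmod5$$ such that $p\nmid x^2-125w^2$.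
   Context: For $k\mid q-1$, the generalized Paley graph $\Gamma(k,q)$ is the Cayley (di)graph with vertex set $\mathbb{F}_q$ and a directed edge from $u$ to $v$ iff $v-u\in\{x^k:x\in\mathbb{F}_q^*\}$. $\mathrm{Spec}$ denotes the multiset of eigenvalues of the adjacency matrix, $[\lambda]^{r}$ meaning that $\lambda$ occurs with multiplicity $r$.
   Formalization: The first equation of the system is taken as 16p^s = x²+125w²+50v²+50u² instead of 16p^m; with m=5s the printed version is false, e.g. p=11, s=1, (x,w,v,u)=(-396,-100,-150,30) gives |(η₀*-1)/5| > n. *)

theory Defs
  imports
    "HOL-Analysis.Analysis"
    "HOL-Computational_Algebra.Computational_Algebra"
    "HOL-Number_Theory.Number_Theory"
    "Graph_Theory.Pair_Digraph"
begin

definition cayley_digraph :: "'a::group_add set \<Rightarrow> 'a pair_pre_digraph" where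
  "cayley_digraph S = \<lparr>pverts = UNIV, parcs = {(u, v). v - u \<in> S}\<rparr>"

text \<open>The finite field with $q$ elements is any field type with \<open>CARD('a) = q\<close>.\<close>

definition gen_paley :: "nat \<Rightarrow> 'a::{field,finite} pair_pre_digraph" where
  "gen_paley k = cayley_digraph {x ^ k | x. x \<noteq> 0}"

text \<open>Rows and columns are indexed by the whole type, so the adjacency matrix below is only
  meaningful for digraphs with vertex set \<open>UNIV\<close>, such as Cayley digraphs.\<close>

definition adjacency_matrix :: "'a::finite pair_pre_digraph \<Rightarrow> complex ^ 'a ^ 'a" where
  "adjacency_matrix G = (\<chi> u v. if (u, v) \<in> parcs G then 1 else 0)"

definition charpoly :: "'b::comm_ring_1 ^ 'n ^ 'n \<Rightarrow> 'b poly" where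
  "charpoly A = det (mat [:0, 1:] - (\<chi> i j. [:A $ i $ j:]))"

text \<open>\<^const>\<open>proots\<close> counts each root of the (monic, hence nonzero) characteristic polynomial
  with its order, so eigenvalues are listed with algebraic multiplicity.\<close>

definition Spec :: "'a::finite pair_pre_digraph \<Rightarrow> complex multiset" where
  "Spec G = proots (charpoly (adjacency_matrix G))"

definition quintic_L :: "int \<times> int \<times> int \<times> int \<Rightarrow> int" where
  "quintic_L = (\<lambda>(x, w, v, u).
     2 * x * (v^2 + u^2) + 5 * w * (11 * v^2 - 4 * v * u - 11 * u^2))"

definition quintic_M :: "int \<times> int \<times> int \<times> int \<Rightarrow> int" where
  "quintic_M = (\<lambda>(x, w, v, u).
     2 * x^2 * u + 7 * x * v^2 + 20 * x * v * u - 3 * x * u^2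
     + 125 * w^3 + 200 * w^2 * v - 150 * w^2 * u + 5 * w * v^2
     - 20 * w * v * u - 105 * w * u^2 - 40 * v^3 - 60 * v^2 * u
     + 120 * v * u^2 + 20 * u^3)"

definition quintic_sigma :: "int \<times> int \<times> int \<times> int \<Rightarrow> int \<times> int \<times> int \<times> int" where
  "quintic_sigma = (\<lambda>(x, w, v, u). (x, - w, - u, v))"

text \<open>In \<open>eta_star p s z\<close> the tuple \<open>z = (x, w, v, u)\<close> is meant to solve
  \[ 16 p^s = x^2 + 125 w^2 + 50 v^2 + 50 u^2, \quad xw = v^2 - 4uv - u^2, \quad
     x \equiv -1 \pmod 5, \quad p \nmid x^2 - 125 w^2 \]
  for the exponent $s$, not for the exponent $5s$ of $q = p^{5s}$: the values are then of size
  $O(p^s \cdot p^{3s/2}) = O(\sqrt q)$, as they must be for the quintic periods over the field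
  with $q$ elements.
  \<open>fst z\<close> is the coordinate $x$; the iterate of $\sigma$ is applied to the arguments of the whole
  expression $x^3 - 25 M$.\<close>

fun eta_star :: "nat \<Rightarrow> nat \<Rightarrow> int \<times> int \<times> int \<times> int \<Rightarrow> nat \<Rightarrow> complex" where
  "eta_star p s z 0 = - (1 / 16) * of_nat p ^ s * of_int (fst z ^ 3 - 25 * quintic_L z)"
| "eta_star p s z (Suc i) = 1 / 64 * of_nat p ^ s *
     of_int ((\<lambda>z. fst z ^ 3 - 25 * quintic_M z) ((quintic_sigma ^^ i) z))"

end

theory Submission
  imports Defs
begin

text \<open>Let \<open>G\<close> be the Gauss sum of a quintic character over the field with \<open>q = p\<^sup>m\<close> elements.
  The eigenvalues of the graph are the valency and the five Gaussian periods, i.e. essentially the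
  traces of \<open>\<zeta>\<^sup>i G\<close>, where \<open>\<zeta>\<close> is a primitive 5th root of unity. As \<open>5 dvd m\<close>, the prime
  field consists of fifth powers, so the periods are integers and \<open>G \<in> \<int>[\<zeta>]\<close>. From
  \<open>G\<^sup>5 = q J(\<chi>,\<chi>)\<^sup>2 J(\<chi>,\<chi>\<^sup>2)\<close>, \<open>J J' = q\<close> (with \<open>J'\<close> the conjugate of \<open>J\<close>) and the
  reductions of the Jacobi sums modulo \<open>p\<close>, which are binomial coefficients, one reads off the
  exact power of each of the four primes above \<open>p\<close> that divides \<open>G\<close>.

  A solution \<open>(x, w, v, u)\<close> encodes \<open>S \<in> \<int>[\<zeta>]\<close> with \<open>S S' = r = p\<^sup>s\<close>, and the condition
  \<open>\<not> p dvd x\<^sup>2 - 125 w\<^sup>2\<close> says that \<open>S\<close> and \<open>S'\<close> have no common prime above \<open>p\<close>. Hence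
  \<open>G\<close> and a conjugate of \<open>\<gamma> = r S\<^sup>2 \<sigma>\<^sub>2(S)\<close> generate the same ideal, and their quotient is a unit all of
  whose conjugates have absolute value 1, i.e. \<open>\<plusminus> \<zeta>\<^sup>l\<close>; the sign is determined modulo
  \<open>1 - \<zeta>\<close> by \<open>x \<equiv> -1\<close>. The traces of \<open>\<zeta>\<^sup>i \<gamma>\<close> are the polynomials in the statement.

  Divisibility in \<open>\<int>[\<zeta>]\<close> by powers of \<open>p\<close> is tested by evaluating integer polynomials at a
  5th root of unity modulo a power of \<open>p\<close>, so no ideal theory is needed.\<close>

section \<open>The ring of integers of the fifth cyclotomic field\<close>

text \<open>Elements of the fifth cyclotomic ring are represented by integer polynomials, so that
  one representative can be evaluated at \<open>zeta5\<close>, at an integer root of unity modulo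
  \<open>p ^ N\<close>, and in the finite field.\<close>

definition eval_int_poly :: "int poly \<Rightarrow> 'r::comm_ring_1 \<Rightarrow> 'r" where
  "eval_int_poly P z = poly (map_poly of_int P) z"

lemma eval_int_poly_0 [simp]: "eval_int_poly 0 z = 0"
  by (simp add: eval_int_poly_def)

lemma eval_int_poly_pCons [simp]:
  "eval_int_poly (pCons a P) z = of_int a + z * eval_int_poly P z"
  by (cases "a = 0 \<and> P = 0") (auto simp: eval_int_poly_def map_poly_pCons)

lemma eval_int_poly_1 [simp]: "eval_int_poly 1 z = 1"
  by (simp add: one_pCons)

lemma eval_int_poly_add [simp]:
  "eval_int_poly (P + Q) z = eval_int_poly P z + eval_int_poly Q z"
proof (induction P arbitrary: Q)
  case (pCons a P)
  obtain b R where "Q = pCons b R" by (cases Q)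
  then show ?case using pCons.IH[of R] by (simp add: algebra_simps)
qed simp

lemma eval_int_poly_minus [simp]: "eval_int_poly (- P) z = - eval_int_poly P z"
  by (induction P) (simp_all add: algebra_simps)

lemma eval_int_poly_diff [simp]:
  "eval_int_poly (P - Q) z = eval_int_poly P z - eval_int_poly Q z"
  using eval_int_poly_add[of P "- Q" z] by simp

lemma eval_int_poly_smult [simp]: "eval_int_poly (Polynomial.smult a P) z = of_int a * eval_int_poly P z"
  by (induction P) (simp_all add: algebra_simps)

lemma eval_int_poly_mult [simp]:
  "eval_int_poly (P * Q) z = eval_int_poly P z * eval_int_poly Q z"
  by (induction P) (simp_all add: algebra_simps)

lemma eval_int_poly_power [simp]: "eval_int_poly (P ^ k) z = eval_int_poly P z ^ k"
  by (induction k) simp_all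

lemma eval_int_poly_sum [simp]:
  "eval_int_poly (\<Sum>x\<in>A. P x) z = (\<Sum>x\<in>A. eval_int_poly (P x) z)"
  by (induction A rule: infinite_finite_induct) simp_all

lemma eval_int_poly_monom [simp]: "eval_int_poly (Polynomial.monom a k) z = of_int a * z ^ k"
  by (induction k) (simp_all add: Polynomial.monom_0 monom_Suc mult_ac)

lemma eval_int_poly_pcompose_monom [simp]:
  "eval_int_poly (pcompose P (Polynomial.monom 1 k)) z = eval_int_poly P (z ^ k)"
  by (induction P) (simp_all add: pcompose_pCons)

lemma of_int_eval_int_poly: "of_int (eval_int_poly P t) = eval_int_poly P (of_int t)"
  by (induction P) simp_all

definition cyclo5 :: "int poly" where "cyclo5 = [:1, 1, 1, 1, 1:]"

lemma eval_cyclo5: "eval_int_poly cyclo5 z = 1 + z + z ^ 2 + z ^ 3 + z ^ 4"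
  by (simp add: cyclo5_def algebra_simps eval_nat_numeral)

text \<open>Prepending a coefficient shifts the remainder; the resulting term of degree 4 is removed
  with \<open>b3\<close> times \<open>cyclo5\<close>.\<close>

lemma cyclo5_reduce: "\<exists>b0 b1 b2 b3 Q. P = [:b0, b1, b2, b3:] + cyclo5 * Q"
proof (induction P)
  case 0
  show ?case by (rule exI[of _ 0])+ simp
next
  case (pCons a P)
  then obtain b0 b1 b2 b3 Q where P: "P = [:b0, b1, b2, b3:] + cyclo5 * Q" by blast
  have "pCons a P = [:a - b3, b0 - b3, b1 - b3, b2 - b3:] + cyclo5 * pCons b3 Q"
    unfolding P cyclo5_def by (simp add: algebra_simps)
  then show ?case by blast
qed

lemma root5_power:
  fixes z :: "'r::comm_ring_1"
  assumes "1 + z + z ^ 2 + z ^ 3 + z ^ 4 = 0"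
  shows "z ^ 5 = 1"
proof -
  have "z ^ 5 - 1 = (z - 1) * (1 + z + z ^ 2 + z ^ 3 + z ^ 4)"
    by (simp add: algebra_simps eval_nat_numeral)
  with assms show ?thesis by simp
qed

lemma power_root5_mod:
  fixes z :: "'r::comm_ring_1"
  assumes "z ^ 5 = 1" shows "z ^ k = z ^ (k mod 5)"
proof -
  have "z ^ k = (z ^ 5) ^ (k div 5) * z ^ (k mod 5)"
    by (simp flip: power_mult power_add)
  with assms show ?thesis by simp
qed

lemma root5_conj:
  fixes z :: "'r::comm_ring_1"
  assumes "1 + z + z ^ 2 + z ^ 3 + z ^ 4 = 0" and "\<not> 5 dvd k"
  shows "1 + z ^ k + (z ^ k) ^ 2 + (z ^ k) ^ 3 + (z ^ k) ^ 4 = 0"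
proof -
  have z5: "z ^ 5 = 1" using root5_power assms(1) .
  have k: "(z ^ k) ^ i = z ^ ((k mod 5) * i mod 5)" for i
    by (simp add: power_root5_mod[OF z5, of "k * i"] mod_mult_left_eq flip: power_mult)
  have "k mod 5 \<in> {1, 2, 3, 4}" using assms(2) by (auto simp: dvd_eq_mod_eq_0)
  then show ?thesis using assms(1) k[of 1] k[of 2] k[of 3] k[of 4]
    by (auto simp: algebra_simps power2_eq_square)
qed

section \<open>The complex fifth root of unity and the independence of its powers\<close>

definition zeta5 :: complex where "zeta5 = cis (2 * pi / 5)"

lemma zeta5_power: "zeta5 ^ k = cis (2 * pi * real k / 5)"
  unfolding zeta5_def Complex.DeMoivre by (simp add: mult_ac)

lemma zeta5_power_5: "zeta5 ^ 5 = 1"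
  by (simp add: zeta5_power)

lemma zeta5_neq_1: "zeta5 \<noteq> 1"
proof
  assume "zeta5 = 1"
  then have "Im zeta5 = 0" by simp
  moreover have "sin (2 * pi / 5) > 0" by (rule sin_gt_zero) (use pi_gt_zero in auto)
  ultimately show False by (simp add: zeta5_def)
qed

lemma zeta5_root: "1 + zeta5 + zeta5 ^ 2 + zeta5 ^ 3 + zeta5 ^ 4 = 0"
proof -
  have "(zeta5 - 1) * (1 + zeta5 + zeta5 ^ 2 + zeta5 ^ 3 + zeta5 ^ 4) = zeta5 ^ 5 - 1"
    by (simp add: algebra_simps eval_nat_numeral)
  with zeta5_power_5 zeta5_neq_1 show ?thesis by simp
qed

lemma sqrt5_irrational:
  fixes a b :: int
  assumes "of_int a + of_int b * sqrt 5 = (0::real)"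
  shows "a = 0 \<and> b = 0"
proof -
  have "of_int a ^ 2 = of_int b ^ 2 * (5::real)"
  proof -
    have "of_int a = - (of_int b * sqrt 5 :: real)" using assms by linarith
    then show ?thesis by (simp add: power_mult_distrib)
  qed
  then have eq: "a ^ 2 = 5 * b ^ 2"
    by (metis (mono_tags) mult.commute of_int_eq_iff of_int_mult of_int_numeral of_int_power)
  have "b = 0"
  proof (rule ccontr)
    assume b: "b \<noteq> 0"
    have p5: "prime_elem (5::int)" by (rule prime_imp_prime_elem) (simp add: prime_int_numeral_eq)
    from eq b have a: "a \<noteq> 0" by auto
    have "multiplicity 5 (a ^ 2) = multiplicity 5 (5 * b ^ 2)" using eq by simp
    then have "2 * multiplicity 5 a = Suc (2 * multiplicity 5 b)"
      using a b p5 by (simp add: prime_elem_multiplicity_power_distrib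
        prime_elem_multiplicity_mult_distrib)
    then show False by presburger
  qed
  with eq show ?thesis by simp
qed

lemma zeta5_conj: "cnj zeta5 = zeta5 ^ 4"
proof -
  have "zeta5 * cnj zeta5 = 1" by (simp add: zeta5_def cis_cnj cis_mult)
  moreover have "zeta5 * zeta5 ^ 4 = 1" using zeta5_power_5 by (simp add: eval_nat_numeral)
  moreover have "zeta5 \<noteq> 0" using zeta5_power_5 by auto
  ultimately show ?thesis by (metis mult_left_cancel)
qed

text \<open>Imaginary and real part each give an integer linear relation between 1 and
  \<open>sqrt 5\<close>, because the cosine \<open>c\<close> satisfies
  \<open>4 * c + 1 = sqrt 5\<close>.\<close>

lemma zeta5_indep:
  assumes "eval_int_poly [:b0, b1, b2, b3:] zeta5 = 0"
  shows "b0 = 0 \<and> b1 = 0 \<and> b2 = 0 \<and> b3 = 0"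
proof -
  define c where "c = Re zeta5"
  define d where "d = Im zeta5"
  have z: "zeta5 = Complex c d" by (simp add: c_def d_def complex_eq_iff)
  have dpos: "d > 0" unfolding d_def zeta5_def
    by simp (rule sin_gt_zero, use pi_gt_zero in auto)
  have cpos: "c > 0" unfolding c_def zeta5_def
    by simp (rule cos_gt_zero, use pi_gt_zero in auto)
  have n1: "c\<^sup>2 + d\<^sup>2 = 1" unfolding c_def d_def zeta5_def by (simp add: add.commute)
  have z4: "zeta5 ^ 4 = Complex c (- d)" using zeta5_conj by (simp add: z complex_eq_iff)
  have z2: "zeta5 ^ 2 = Complex (2 * c\<^sup>2 - 1) (2 * c * d)"
    using n1 by (simp add: z complex_eq_iff power2_eq_square algebra_simps)
  have z3: "zeta5 ^ 3 = Complex (2 * c\<^sup>2 - 1) (- 2 * c * d)"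
  proof -
    have "zeta5 ^ 3 = (zeta5 ^ 4) ^ 2"
      using power_root5_mod[OF zeta5_power_5, of 8] by (simp flip: power_mult)
    also have "\<dots> = Complex (2 * c\<^sup>2 - 1) (- 2 * c * d)"
      unfolding z4 using n1 by (simp add: complex_eq_iff power2_eq_square algebra_simps)
    finally show ?thesis .
  qed
  have "Re (1 + zeta5 + zeta5 ^ 2 + zeta5 ^ 3 + zeta5 ^ 4) = 0"
    using zeta5_root by simp
  then have q: "4 * c\<^sup>2 + 2 * c = 1"
    unfolding z2 z3 z4 by (simp add: c_def)
  then have "(4 * c + 1)\<^sup>2 = (sqrt 5)\<^sup>2"
    by (simp add: power2_eq_square algebra_simps)
  then have c: "4 * c + 1 = sqrt 5"
    using cpos by (subst (asm) power2_eq_iff_nonneg) auto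
  have E: "of_int b0 + of_int b1 * zeta5 + of_int b2 * zeta5 ^ 2 + of_int b3 * zeta5 ^ 3 = 0"
    using assms by (simp add: algebra_simps eval_nat_numeral)
  have "d * (of_int b1 + (of_int b2 - of_int b3) * (2 * c)) = 0"
    using arg_cong[OF E, of Im] unfolding z2 z3 by (simp add: z algebra_simps)
  then have "of_int b1 + (of_int b2 - of_int b3) * (2 * c) = 0" using dpos by simp
  then have "of_int (2 * b1 - (b2 - b3)) + of_int (b2 - b3) * sqrt 5 = 0"
    unfolding c[symmetric] by (simp add: algebra_simps)
  then have b1: "b1 = 0" "b2 = b3" using sqrt5_irrational[of "2 * b1 - (b2 - b3)" "b2 - b3"] by auto
  have "of_int b0 + (of_int b2 + of_int b3) * (2 * c\<^sup>2 - 1) = 0"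
    using arg_cong[OF E, of Re] unfolding z2 z3 by (simp add: b1 algebra_simps)
  then have "of_int b0 + of_int b2 * (4 * c\<^sup>2 - 2) = 0"
    using b1 by (simp add: algebra_simps)
  moreover have "4 * c\<^sup>2 - 2 = - 2 * c - 1" using q by simp
  ultimately have "of_int b0 + of_int b2 * (- 2 * c - 1) = 0" by simp
  then have "of_int (2 * b0 - b2) + of_int (- b2) * sqrt 5 = 0"
    unfolding c[symmetric] by (simp add: algebra_simps)
  then have "b2 = 0" "b0 = 0" using sqrt5_irrational[of "2 * b0 - b2" "- b2"] by auto
  with b1 show ?thesis by simp
qed

lemma cyclo5_dvd:
  assumes "eval_int_poly P zeta5 = 0" shows "cyclo5 dvd P"
proof -
  obtain b0 b1 b2 b3 Q where P: "P = [:b0, b1, b2, b3:] + cyclo5 * Q"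
    using cyclo5_reduce by blast
  have "eval_int_poly [:b0, b1, b2, b3:] zeta5 = 0"
    using assms zeta5_root unfolding P eval_int_poly_add eval_int_poly_mult eval_cyclo5 by simp
  with zeta5_indep P show ?thesis by fastforce
qed

text \<open>Sending \<open>zeta5\<close> to \<open>t\<close> is a well-defined ring homomorphism to
  the integers modulo \<open>N\<close>, since \<open>cyclo5\<close> generates the kernel of
  evaluation at \<open>zeta5\<close>. Identities between complex numbers thus become
  congruences.\<close>

lemma eval_int_poly_zeta5_transfer:
  assumes "eval_int_poly P zeta5 = eval_int_poly Q zeta5"
    and "N dvd eval_int_poly cyclo5 (t::int)"
  shows "[eval_int_poly P t = eval_int_poly Q t] (mod N)"
proof -
  have "cyclo5 dvd P - Q" using assms(1) by (intro cyclo5_dvd) simp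
  then have "eval_int_poly cyclo5 t dvd eval_int_poly (P - Q) t"
    by (elim dvdE) (simp only: eval_int_poly_mult dvd_triv_left)
  from dvd_trans[OF assms(2) this] show ?thesis by (simp add: cong_iff_dvd_diff)
qed

lemma cyclo5_dvd_conj:
  assumes "N dvd eval_int_poly cyclo5 (t::int)" "\<not> 5 dvd k"
  shows "N dvd eval_int_poly cyclo5 (t ^ k)"
proof -
  have "eval_int_poly (pcompose cyclo5 (Polynomial.monom 1 k)) zeta5 = eval_int_poly 0 zeta5"
    using root5_conj[OF zeta5_root assms(2)] by (simp add: eval_cyclo5)
  from eval_int_poly_zeta5_transfer[OF this assms(1)] show ?thesis
    by (simp add: cong_0_iff)
qed

lemma root5_sum:
  fixes z :: "'r::comm_ring_1"
  assumes "1 + z + z ^ 2 + z ^ 3 + z ^ 4 = 0"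
  shows "(\<Sum>j=1..4. z ^ (j * e)) = (if 5 dvd e then 4 else - 1)"
proof -
  have *: "(\<Sum>j=1..4. z ^ (j * e)) = z ^ e + (z ^ e) ^ 2 + (z ^ e) ^ 3 + (z ^ e) ^ 4"
    by (simp add: eval_nat_numeral power_add)
  show ?thesis
  proof (cases "5 dvd e")
    case True
    then have "z ^ e = 1" using root5_power[OF assms] by (auto simp: power_mult)
    with * True show ?thesis by simp
  next
    case False
    from root5_conj[OF assms False] * show ?thesis
      using False by (simp add: eq_neg_iff_add_eq_0 algebra_simps)
  qed
qed

text \<open>Each power of \<open>z\<close> has trace 4 or -1, so the trace of the element multiplied
  by the \<open>- k\<close>-th power of \<open>z\<close> isolates the coefficient
  \<open>b k\<close>; the exponent \<open>5 - k\<close> stands for \<open>- k\<close>.\<close>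

lemma root5_trace:
  fixes z :: "'r::comm_ring_1" and b :: "nat \<Rightarrow> 'r"
  assumes "1 + z + z ^ 2 + z ^ 3 + z ^ 4 = 0" and "k < 5"
  shows "(\<Sum>j=1..4. z ^ (j * (5 - k)) * (\<Sum>i<5. b i * z ^ (i * j))) = 5 * b k - (\<Sum>i<5. b i)"
proof -
  have "(\<Sum>j=1..4. z ^ (j * (5 - k)) * (\<Sum>i<5. b i * z ^ (i * j)))
      = (\<Sum>i<5. b i * (\<Sum>j=1..4. z ^ (j * (5 - k + i))))"
    unfolding sum_distrib_left by (subst sum.swap) (simp add: algebra_simps power_add)
  also have "\<dots> = (\<Sum>i<5. b i * (if i = k then 4 else - 1))"
  proof (rule sum.cong)
    fix i assume i: "i \<in> {..<5::nat}"
    have "5 dvd 5 - k + i \<longleftrightarrow> i = k" using i assms(2) by auto presburger+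
    then show "b i * (\<Sum>j=1..4. z ^ (j * (5 - k + i))) = b i * (if i = k then 4 else - 1)"
      by (simp only: root5_sum[OF assms(1)])
  qed simp
  also have "\<dots> = (\<Sum>i<5. (if i = k then 5 * b i else 0) - b i)"
    by (rule sum.cong) (auto simp: algebra_simps)
  also have "\<dots> = 5 * b k - (\<Sum>i<5. b i)"
    using assms(2) by (simp add: sum_subtractf)
  finally show ?thesis .
qed

text \<open>Divisibility by \<open>q\<close> in \<open>\<int>[\<zeta>]\<close> may be tested at all conjugates of a
  5th root of unity modulo \<open>q\<close>, because the discriminant is a power of 5.\<close>

lemma cyclo5_divisible:
  assumes "coprime 5 (q::int)" and t: "q dvd eval_int_poly cyclo5 t"
    and P: "\<And>j. j \<in> {1..4} \<Longrightarrow> q dvd eval_int_poly P (t ^ j)"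
  shows "\<exists>U Q. P = Polynomial.smult q U + cyclo5 * Q"
proof -
  obtain b0 b1 b2 b3 Q where PQ: "P = [:b0, b1, b2, b3:] + cyclo5 * Q"
    using cyclo5_reduce by blast
  define b where "b = (\<lambda>i::nat. [b0, b1, b2, b3, 0] ! i)"
  have ev: "eval_int_poly [:b0, b1, b2, b3:] z = (\<Sum>i<5. of_int (b i) * z ^ i)" for z :: "'z::comm_ring_1"
    by (simp add: b_def eval_nat_numeral algebra_simps)
  have ev': "eval_int_poly [:b0, b1, b2, b3:] (z ^ j) = (\<Sum>i<5. of_int (b i) * z ^ (i * j))"
    for z :: "'z::comm_ring_1" and j unfolding ev by (simp add: mult.commute flip: power_mult)
  have F: "q dvd eval_int_poly [:b0, b1, b2, b3:] (t ^ j)" if "j \<in> {1..4}" for j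
  proof -
    have "\<not> 5 dvd j" using that by auto
    from cyclo5_dvd_conj[OF t this] P[OF that] show ?thesis
      unfolding PQ by (simp add: dvd_add_left_iff)
  qed
  have D: "q dvd 5 * b k - (\<Sum>i<5. b i)" if "k < 5" for k
  proof -
    \<comment> \<open>This trace, written as a polynomial, is an integer constant at
      \<open>zeta5\<close>, while at \<open>t\<close> each summand is divisible by
      \<open>q\<close>.\<close>
    define R where "R = (\<Sum>j=1..4. Polynomial.monom 1 (j * (5 - k)) * pcompose [:b0, b1, b2, b3:] (Polynomial.monom 1 j))"
    have "eval_int_poly R zeta5 = eval_int_poly [:5 * b k - (\<Sum>i<5. b i):] zeta5"
      unfolding R_def eval_int_poly_sum eval_int_poly_mult eval_int_poly_monom
        eval_int_poly_pcompose_monom ev'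
      using root5_trace[OF zeta5_root that, of "\<lambda>i. of_int (b i)"] by simp
    from eval_int_poly_zeta5_transfer[OF this t]
    have "[eval_int_poly R t = 5 * b k - (\<Sum>i<5. b i)] (mod q)" by simp
    moreover have "q dvd eval_int_poly R t"
      unfolding R_def eval_int_poly_sum eval_int_poly_mult eval_int_poly_monom
        eval_int_poly_pcompose_monom
      by (intro dvd_sum dvd_mult F) 
    ultimately show ?thesis by (metis cong_dvd_iff cong_sym)
  qed
  have q5: "q dvd a" if "q dvd 5 * a" for a
    using that assms(1) by (metis coprime_commute coprime_dvd_mult_right_iff)
  \<comment> \<open>The padding coefficient \<open>b 4\<close> is zero, so the case
    \<open>k = 4\<close> shows that \<open>q\<close> divides the coefficient sum, and the other
    cases then give \<open>q dvd 5 * b k\<close>.\<close>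
  have "b 4 = 0" by (simp add: b_def)
  then have sum: "q dvd (\<Sum>i<5. b i)" using D[of 4] by simp
  have *: "q dvd b k" if "k < 5" for k
  proof (rule q5)
    from dvd_add[OF D[OF that] sum] show "q dvd 5 * b k" by (simp only: diff_add_cancel)
  qed
  have "q dvd b0" "q dvd b1" "q dvd b2" "q dvd b3"
    using *[of 0] *[of 1] *[of 2] *[of 3] by (simp_all add: b_def)
  then obtain c0 c1 c2 c3 where "b0 = q * c0" "b1 = q * c1" "b2 = q * c2" "b3 = q * c3"
    by (auto simp: dvd_def)
  then have "P = Polynomial.smult q [:c0, c1, c2, c3:] + cyclo5 * Q" unfolding PQ by simp
  then show ?thesis by blast
qed

section \<open>Lifting fifth roots of unity to prime power moduli\<close>

lemma cong_1_power_prime: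
  fixes a :: int
  assumes "[a = 1] (mod int p ^ k)" "k \<ge> 1"
  shows "[a ^ p = 1] (mod int p ^ Suc k)"
proof -
  have "[a = 1] (mod int p)"
    using assms by (metis cong_dvd_modulus dvd_power not_one_le_zero zero_less_iff_neq_zero)
  then have "[(\<Sum>i<p. a ^ i) = (\<Sum>i<p. 1 ^ i)] (mod int p)"
    by (intro cong_sum cong_pow)
  then have "int p dvd (\<Sum>i<p. a ^ i)" by (simp add: cong_dvd_iff)
  moreover have "int p ^ k dvd a - 1" using assms(1) by (simp add: cong_iff_dvd_diff)
  \<comment> \<open>\<open>a ^ p - 1\<close> is \<open>a - 1\<close> times the geometric sum, and
    the latter, being congruent to \<open>p\<close>, contributes one more factor
    \<open>p\<close>.\<close>
  ultimately have "int p ^ k * int p dvd (a - 1) * (\<Sum>i<p. a ^ i)"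
    by (intro mult_dvd_mono)
  then show ?thesis
    by (simp add: cong_iff_dvd_diff power_diff_1_eq mult.commute)
qed

lemma cong_1_power_prime_power:
  fixes a :: int
  assumes "[a = 1] (mod int p)"
  shows "[a ^ (p ^ k) = 1] (mod int p ^ Suc k)"
proof (induction k)
  case (Suc k)
  from cong_1_power_prime[OF Suc] show ?case by (simp add: power_mult mult.commute flip: power_mult)
qed (use assms in simp)

lemma fermat_prime_power:
  assumes "prime p" shows "[c ^ (p ^ k) = c] (mod p)"
proof (induction k)
  case (Suc k)
  have *: "[a ^ p = a] (mod p)" for a
  proof (cases "p dvd a")
    case True
    have "a dvd a ^ p" by (rule dvd_power) (use assms prime_gt_0_nat in blast)
    then have "p dvd a ^ p" by (rule dvd_trans[OF True])
    then have "a mod p = 0" "a ^ p mod p = 0" using True by (simp_all add: dvd_eq_mod_eq_0)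
    then show ?thesis unfolding cong_def by (simp only:)
  next
    case False
    from cong_scalar_left[OF fermat_theorem[OF assms False], of a] show ?thesis
      using assms prime_gt_0_nat[of p] by (simp add: power_eq_if)
  qed
  have "[(c ^ p ^ k) ^ p = c] (mod p)"
    using *[of "c ^ p ^ k"] Suc cong_trans by blast
  then show ?case by (simp add: mult.commute flip: power_mult)
qed simp

text \<open>The Teichmueller approximation \<open>c ^ (p ^ N)\<close> works: by Fermat it stays
  congruent to \<open>c\<close>, its fifth power is 1 modulo a high power of \<open>p\<close>, and
  \<open>t - 1\<close> is prime to \<open>p\<close> because \<open>p \<noteq> 5\<close>.\<close>

lemma cyclo5_root_lift:
  fixes c :: nat
  assumes "prime p" "p \<noteq> 5" "int p dvd eval_int_poly cyclo5 (int c)"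
  shows "\<exists>t. [t = int c] (mod int p) \<and> int p ^ N dvd eval_int_poly cyclo5 t"
proof -
  define t where "t = int c ^ (p ^ N)"
  have tc: "[t = int c] (mod int p)"
    using fermat_prime_power[OF assms(1), of c N] unfolding t_def by (metis cong_int_iff of_nat_power)
  have eq: "(a - 1) * eval_int_poly cyclo5 a = a ^ 5 - 1" for a :: int
    by (simp add: eval_cyclo5 algebra_simps eval_nat_numeral)
  have "[int c ^ 5 = 1] (mod int p)"
    using dvd_mult[OF assms(3), of "int c - 1"] unfolding eq cong_iff_dvd_diff .
  from cong_1_power_prime_power[OF this, of N]
  have "[t ^ 5 = 1] (mod int p ^ Suc N)" by (simp add: t_def mult.commute flip: power_mult)
  then have d: "int p ^ N dvd (t - 1) * eval_int_poly cyclo5 t"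
    unfolding eq cong_iff_dvd_diff by (rule dvd_trans[rotated]) (simp add: le_imp_power_dvd)
  have "\<not> int p dvd t - 1"
  proof
    assume "int p dvd t - 1"
    then have "[t = 1] (mod int p)" by (simp add: cong_iff_dvd_diff)
    then have "[int c = 1] (mod int p)" by (rule cong_trans[OF cong_sym[OF tc]])
    then have "[eval_int_poly cyclo5 (int c) = 1 + 1 + 1 ^ 2 + 1 ^ 3 + 1 ^ 4] (mod int p)"
      unfolding eval_cyclo5 by (intro cong_add cong_pow cong_refl)
    then have "int p dvd 5" using assms(3) by (simp add: cong_dvd_iff)
    then have "p dvd 5" by (metis int_dvd_int_iff of_nat_numeral)
    moreover have "prime (5::nat)" by simp
    ultimately show False using assms(1,2) primes_dvd_imp_eq by blast
  qed
  then have "coprime (int p ^ N) (t - 1)"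
    using assms(1) by (simp add: prime_imp_coprime)
  with d tc show ?thesis by (auto simp: coprime_dvd_mult_right_iff)
qed

section \<open>Finite fields\<close>

lemma finite_field_power_card_minus_1:
  fixes x :: "'a::{field,finite}"
  assumes "x \<noteq> 0" shows "x ^ (CARD('a) - 1) = 1"
proof -
  have "(\<Prod>y\<in>UNIV-{0}. x * y) = x ^ (CARD('a) - 1) * \<Prod>(UNIV - {0::'a})"
    by (simp add: prod.distrib)
  moreover have "(\<Prod>y\<in>UNIV-{0}. x * y) = \<Prod>(UNIV - {0::'a})"
    by (rule prod.reindex_bij_witness[of _ "\<lambda>y. y / x" "\<lambda>y. x * y"]) (use assms in auto)
  moreover have "\<Prod>(UNIV - {0::'a}) \<noteq> 0" by simp
  ultimately show ?thesis by simp
qed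

lemma card_power_eq_le:
  fixes c :: "'a::idom"
  assumes "k > 0" shows "finite {x. x ^ k = c}" "card {x. x ^ k = c} \<le> k"
proof -
  define P where "P = Polynomial.monom 1 k + [:- c:]"
  have "degree P = k" unfolding P_def using assms
    by (subst degree_add_eq_left) (auto simp: degree_monom_eq)
  moreover from this assms have "P \<noteq> 0" by auto
  moreover have "{x. x ^ k = c} = {x. poly P x = 0}" by (simp add: P_def poly_monom)
  ultimately show "finite {x. x ^ k = c}" "card {x. x ^ k = c} \<le> k"
    using card_poly_roots_bound[of P] poly_roots_finite[of P] by auto
qed

lemma finite_field_char:
  assumes "CARD('a::{field,finite}) = p ^ m" "prime p"
  shows "CHAR('a) = p"
proof -
  have "prime CHAR('a)" by (intro prime_CHAR_semidom finite_imp_CHAR_pos) simp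
  moreover have "CHAR('a) dvd p ^ m" using CHAR_dvd_CARD[where ?'a = 'a] assms(1) by simp
  ultimately show ?thesis using assms(2) prime_dvd_power primes_dvd_imp_eq by blast
qed

text \<open>\<open>y ^ p - y\<close> has at most \<open>p\<close> roots, and the prime field already
  supplies that many.\<close>

lemma prime_subfield:
  assumes "CARD('a::{field,finite}) = p ^ m" "prime p" "x ^ p = (x::'a)"
  shows "\<exists>k<p. x = of_nat k"
proof -
  have char: "CHAR('a) = p" using finite_field_char assms(1,2) .
  have inj: "inj_on (of_nat :: nat \<Rightarrow> 'a) {..<p}"
    by (rule inj_onI) (auto simp: of_nat_eq_iff_cong_CHAR char cong_less_modulus_unique_nat)
  have sub: "of_nat ` {..<p} \<subseteq> {y::'a. y ^ p = y}"
  proof safe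
    fix k
    have "[k ^ p = k] (mod p)" using fermat_prime_power[OF assms(2), of k 1] by simp
    then have "of_nat (k ^ p) = (of_nat k :: 'a)" by (simp only: of_nat_eq_iff_cong_CHAR char)
    then show "of_nat k ^ p = (of_nat k :: 'a)" by simp
  qed
  define P :: "'a poly" where "P = Polynomial.monom 1 p + [:0, - 1:]"
  have p1: "p > 1" using assms(2) prime_gt_1_nat by blast
  have "degree P = p" unfolding P_def using p1
    by (subst degree_add_eq_left) (auto simp: degree_monom_eq)
  moreover from this p1 have "P \<noteq> 0" by auto
  moreover have "{y::'a. y ^ p = y} = {y. poly P y = 0}" by (simp add: P_def poly_monom)
  ultimately have "card {y::'a. y ^ p = y} \<le> p"
    using card_poly_roots_bound[of P] by auto
  with sub inj have "of_nat ` {..<p} = {y::'a. y ^ p = y}"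
    by (intro card_seteq) (auto simp: card_image)
  with assms(3) show ?thesis by force
qed

text \<open>The functional is the absolute trace, read in the prime field through representatives
  below \<open>p\<close>. It cannot vanish identically, being a nonzero polynomial of degree less
  than the number of field elements.\<close>

lemma exists_prime_functional:
  assumes "CARD('a::{field,finite}) = p ^ m" "prime p" "m > 0"
  shows "\<exists>T :: 'a \<Rightarrow> nat. (\<forall>x. T x < p) \<and> (\<forall>x y. [T (x + y) = T x + T y] (mod p)) \<and> (\<exists>x. T x \<noteq> 0)"
proof -
  define tr :: "'a \<Rightarrow> 'a" where "tr = (\<lambda>x. \<Sum>i<m. x ^ (p ^ i))"
  have char: "CHAR('a) = p" using finite_field_char assms(1,2) .
  have p1: "p > 1" using assms(2) prime_gt_1_nat by blast
  have q: "x ^ (p ^ m) = x" for x :: 'a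
  proof (cases "x = 0")
    case False
    have "x ^ (p ^ m) = x * x ^ (CARD('a) - 1)"
      using p1 assms(1) by (simp flip: power_Suc)
    then show ?thesis using finite_field_power_card_minus_1[OF False] by simp
  qed (use p1 in simp)
  \<comment> \<open>Frobenius shifts the summands cyclically since
    \<open>x ^ (p ^ m) = x\<close>.\<close>
  have "tr x ^ p = tr x" for x
  proof -
    have "prime CHAR('a)" using char assms(2) by (simp only:)
    then have "tr x ^ p = (\<Sum>i<m. (x ^ (p ^ i)) ^ p)"
      unfolding tr_def by (rule freshmans_dream_sum) (rule char[symmetric])
    also have "\<dots> = (\<Sum>i<m. x ^ (p ^ Suc i))"
      by (simp only: power_mult[symmetric] power_Suc2[symmetric])
    also have "\<dots> = (\<Sum>i<m. x ^ (p ^ Suc i)) + x ^ (p ^ 0) - x ^ (p ^ m)" using q[of x] by simp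
    also have "\<dots> = tr x" unfolding tr_def diff_eq_eq
      using sum.lessThan_Suc_shift[of "\<lambda>i. x ^ (p ^ i)" m] sum.lessThan_Suc[of "\<lambda>i. x ^ (p ^ i)" m]
      by (simp only: comp_def add.commute)
    finally show ?thesis .
  qed
  then have "\<forall>x. \<exists>k. k < p \<and> tr x = of_nat k" using prime_subfield[OF assms(1,2)] by simp
  from choice[OF this] obtain T where T: "\<And>x. T x < p" "\<And>x. tr x = of_nat (T x)" by auto
  have "tr (x + y) = tr x + tr y" for x y
  proof -
    have "(x + y) ^ (p ^ i) = x ^ (p ^ i) + y ^ (p ^ i)" for i
      by (rule freshmans_dream'[where n = i]) (simp_all add: char assms(2))
    then show ?thesis by (simp only: tr_def sum.distrib)
  qed
  then have "[T (x + y) = T x + T y] (mod p)" for x y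
    unfolding T(2) of_nat_add[symmetric] of_nat_eq_iff_cong_CHAR char .
  moreover have "\<exists>x. T x \<noteq> 0"
  proof (rule ccontr)
    assume "\<not> ?thesis"
    then have tr0: "tr x = 0" for x by (simp add: T(2))
    define P :: "'a poly" where "P = (\<Sum>i<m. Polynomial.monom 1 (p ^ i))"
    have cf: "Polynomial.coeff P 1 = 1"
      unfolding P_def coeff_sum using assms(3) p1
      by (subst sum.remove[of _ 0]) (auto intro!: sum.neutral)
    then have "P \<noteq> 0" by auto
    have "degree P \<le> p ^ (m - 1)" unfolding P_def
    proof (rule degree_sum_le)
      fix i assume "i \<in> {..<m}"
      then have "p ^ i \<le> p ^ (m - 1)" using p1 by (intro power_increasing) auto
      then show "degree (Polynomial.monom (1::'a) (p ^ i)) \<le> p ^ (m - 1)"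
        using degree_monom_le by (rule order_trans[rotated])
    qed simp
    also have "\<dots> < p ^ m" using p1 assms(3) by (simp add: power_strict_increasing)
    finally have "degree P < CARD('a)" using assms(1) by simp
    moreover have "card {x. poly P x = 0} = CARD('a)"
    proof -
      have "poly P x = tr x" for x by (simp add: P_def tr_def poly_sum poly_monom)
      then show ?thesis by (simp only: tr0) simp
    qed
    moreover have "card {x. poly P x = 0} \<le> degree P"
      using card_poly_roots_bound[OF \<open>P \<noteq> 0\<close>] .
    ultimately show False by linarith
  qed
  ultimately have "(\<forall>x. T x < p) \<and> (\<forall>x y. [T (x + y) = T x + T y] (mod p)) \<and> (\<exists>x. T x \<noteq> 0)"
    using T(1) by simp
  then show ?thesis by (rule exI[of _ T])
qed

section \<open>Powers of a prime in factorials and binomial coefficients\<close>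

lemma fact_prime_part:
  assumes "prime (p::nat)"
  shows "\<exists>U. fact n = p ^ (n div p) * fact (n div p) * U \<and> \<not> p dvd U"
proof (induction n)
  case 0
  show ?case using assms by (intro exI[of _ 1]) auto
next
  case (Suc n)
  then obtain U where U: "fact n = p ^ (n div p) * fact (n div p) * U" "\<not> p dvd U" by blast
  show ?case
  proof (cases "p dvd Suc n")
    case True
    then have d: "Suc n div p = Suc (n div p)" by (simp add: div_Suc dvd_eq_mod_eq_0)
    have eq: "p * Suc (n div p) = Suc n" using True d by (metis dvd_mult_div_cancel)
    have "fact (Suc n) = p * Suc (n div p) * fact n" by (simp only: eq fact_Suc of_nat_id)
    then have "fact (Suc n) = p ^ (Suc n div p) * fact (Suc n div p) * U"
      by (simp only: d U(1) fact_Suc of_nat_id power_Suc mult_ac)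
    with U(2) show ?thesis by blast
  next
    case False
    then have d: "Suc n div p = n div p" by (simp add: div_Suc dvd_eq_mod_eq_0)
    have "fact (Suc n) = p ^ (Suc n div p) * fact (Suc n div p) * (Suc n * U)"
      unfolding d by (simp only: U(1) fact_Suc of_nat_id mult_ac)
    moreover have "\<not> p dvd Suc n * U" using False U(2) assms prime_dvd_multD by blast
    ultimately show ?thesis by blast
  qed
qed

text \<open>All base-\<open>p\<close> digits of \<open>k * (c * (\<Sum>i<m. p ^ i))\<close> equal
  \<open>k * c\<close>, so the exponent of \<open>p\<close> in the factorial is proportional to
  \<open>k\<close>; the point is that \<open>E\<close> does not depend on \<open>k\<close>.\<close>

lemma fact_repdigit:
  assumes "prime (p::nat)"
  shows "\<exists>E. \<forall>k. k * c < p \<longrightarrow> (\<exists>U. fact (k * (c * (\<Sum>i<m. p ^ i))) = p ^ (k * E) * U \<and> \<not> p dvd U)"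
proof (induction m)
  case 0
  show ?case using assms by (intro exI[of _ 0]) auto
next
  case (Suc m)
  then obtain E where E: "\<And>k. k * c < p \<Longrightarrow> \<exists>U. fact (k * (c * (\<Sum>i<m. p ^ i))) = p ^ (k * E) * U \<and> \<not> p dvd U"
    by blast
  define N where "N = c * (\<Sum>i<m. p ^ i)"
  have "(\<Sum>i<Suc m. p ^ i) = p * (\<Sum>i<m. p ^ i) + 1"
    unfolding sum.lessThan_Suc_shift by (simp add: sum_distrib_left)
  then have N': "c * (\<Sum>i<Suc m. p ^ i) = p * N + c" by (simp add: N_def algebra_simps)
  have "\<exists>U. fact (k * (p * N + c)) = p ^ (k * (N + E)) * U \<and> \<not> p dvd U" if k: "k * c < p" for k
  proof -
    have d: "k * (p * N + c) div p = k * N"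
    proof -
      have "k * (p * N + c) = k * c + p * (k * N)" by (simp add: algebra_simps)
      then show ?thesis using k by simp
    qed
    from E[OF k] obtain U where U: "fact (k * N) = p ^ (k * E) * U" "\<not> p dvd U"
      unfolding N_def by blast
    from fact_prime_part[OF assms, of "k * (p * N + c)"] obtain V
      where V: "fact (k * (p * N + c)) = p ^ (k * N) * fact (k * N) * V" "\<not> p dvd V"
      unfolding d by blast
    have "fact (k * (p * N + c)) = p ^ (k * (N + E)) * (U * V)"
      unfolding V(1) U(1) by (simp only: distrib_left power_add mult_ac)
    moreover have "\<not> p dvd U * V" using U(2) V(2) assms by (simp add: prime_dvd_mult_iff)
    ultimately show ?thesis by blast
  qed
  then show ?case unfolding N' by blast
qed

text \<open>The factorials in numerator and denominator contain \<open>p\<close> with exponents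
  \<open>b * E\<close> and \<open>k * E + (b - k) * E\<close>, which cancel. This is the carry-free
  case of Kummer's theorem.\<close>

lemma prime_not_dvd_choose_repdigit:
  assumes "prime (p::nat)" "b * c < p" "k \<le> b" and n: "n = c * (\<Sum>i<m. p ^ i)"
  shows "\<not> p dvd (b * n choose (k * n))"
proof
  assume dvd: "p dvd (b * n choose (k * n))"
  from fact_repdigit[OF assms(1), of c m] obtain E where
    E: "\<And>k. k * c < p \<Longrightarrow> \<exists>U. fact (k * n) = p ^ (k * E) * U \<and> \<not> p dvd U"
    unfolding n by blast
  have le: "j * c < p" if "j \<le> b" for j
    using assms(2) that by (meson le_less_trans mult_le_mono1)
  from E[OF le[of b]] obtain U where U: "fact (b * n) = p ^ (b * E) * U" "\<not> p dvd U" by auto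
  from E[OF le[of k]] assms(3) obtain V where V: "fact (k * n) = p ^ (k * E) * V" by auto
  from E[OF le[of "b - k"]] obtain W where W: "fact ((b - k) * n) = p ^ ((b - k) * E) * W" by auto
  have "fact (k * n) * fact (b * n - k * n) * (b * n choose (k * n)) = fact (b * n)"
    by (rule binomial_fact_lemma) (use assms(3) in simp)
  then have "p ^ (k * E) * V * (p ^ ((b - k) * E) * W) * (b * n choose (k * n)) = p ^ (b * E) * U"
    by (simp only: U V W flip: diff_mult_distrib)
  moreover have "p ^ (k * E) * p ^ ((b - k) * E) = p ^ (b * E)"
    using assms(3) by (simp flip: power_add distrib_right)
  ultimately have "p ^ (b * E) * (V * W * (b * n choose (k * n))) = p ^ (b * E) * U"
    by (metis mult.assoc mult.left_commute)
  moreover have "p ^ (b * E) \<noteq> 0" using assms(1) by auto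
  ultimately have "V * W * (b * n choose (k * n)) = U" by (metis mult_left_cancel)
  with dvd U(2) show False by auto
qed

section \<open>Power sums over a finite field\<close>

lemma finite_field_power_sum:
  assumes "k > 0" "k < 2 * (CARD('a::{field,finite}) - 1)"
  shows "(\<Sum>y\<in>UNIV. (y::'a) ^ k) = (if k = CARD('a) - 1 then - 1 else 0)"
proof (cases "k = CARD('a) - 1")
  case True
  have "(\<Sum>y\<in>UNIV. (y::'a) ^ k) = (\<Sum>y\<in>UNIV. 1 - (if y = (0::'a) then 1 else 0))"
    by (rule sum.cong) (use True assms(1) finite_field_power_card_minus_1 in auto)
  also have "\<dots> = of_nat CARD('a) - 1" by (simp add: sum_subtractf)
  also have "of_nat CARD('a) = (0::'a)"
    using CHAR_dvd_CARD[where ?'a = 'a] by (simp add: of_nat_eq_0_iff_char_dvd)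
  finally show ?thesis using True by simp
next
  case False
  \<comment> \<open>The reduced exponent is smaller than the number of nonzero elements, so some
    \<open>g\<close> has \<open>g ^ r \<noteq> 1\<close>; scaling the summation variable by
    \<open>g\<close> then forces the sum to vanish.\<close>
  define r where "r = k mod (CARD('a) - 1)"
  have r: "y ^ k = y ^ r" if "y \<noteq> 0" for y :: 'a
  proof -
    have "y ^ k = (y ^ (CARD('a) - 1)) ^ (k div (CARD('a) - 1)) * y ^ r"
      unfolding r_def by (simp flip: power_mult power_add)
    then show ?thesis using finite_field_power_card_minus_1[OF that] by simp
  qed
  have c0: "CARD('a) - 1 > 0" using assms by simp
  have r0: "r > 0"
  proof (rule ccontr)
    assume "\<not> r > 0"
    then have "CARD('a) - 1 dvd k" by (simp add: r_def dvd_eq_mod_eq_0)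
    then obtain d where d: "k = (CARD('a) - 1) * d" by blast
    with assms False have "0 < d" "d \<noteq> 1" by (auto intro: Nat.gr0I)
    then have "(CARD('a) - 1) * 2 \<le> k" unfolding d by (intro mult_le_mono2) simp
    with assms(2) show False by simp
  qed
  have "r < CARD('a) - 1" using c0 by (simp add: r_def)
  then have "card {x::'a. x ^ r = 1} < card (UNIV - {0::'a})"
    using card_power_eq_le(2)[OF r0, of "1::'a"] by (simp add: card_Diff_singleton)
  then have "\<not> UNIV - {0} \<subseteq> {x::'a. x ^ r = 1}"
    using card_mono[of "{x::'a. x ^ r = 1}" "UNIV - {0}"] by auto
  then obtain g :: 'a where g: "g \<noteq> 0" "g ^ r \<noteq> 1" by auto
  have "(\<Sum>y\<in>UNIV. y ^ k) = (\<Sum>y\<in>UNIV. (g * y) ^ k)"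
    by (rule sum.reindex_bij_witness[of _ "\<lambda>y. g * y" "\<lambda>y. y / g"]) (use g in auto)
  also have "\<dots> = g ^ k * (\<Sum>y\<in>UNIV. y ^ k)" by (simp add: power_mult_distrib sum_distrib_left)
  finally have "(g ^ k - 1) * (\<Sum>y\<in>UNIV. y ^ k) = 0" by (simp add: algebra_simps)
  then show ?thesis using False g r by simp
qed

text \<open>After expanding \<open>(1 - y) ^ B\<close>, only the term of total exponent
  \<open>CARD('a) - 1\<close> has a nonzero power sum. Its value -1 is absorbed into the exponent of
  the sign.\<close>

lemma finite_field_jacobi_power_sum:
  fixes A B :: nat
  assumes "0 < A" "A \<le> CARD('a::{field,finite}) - 1" "A + B < 2 * (CARD('a) - 1)"
  shows "(\<Sum>y\<in>UNIV. (y::'a) ^ A * (1 - y) ^ B) =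
    (if A + B < CARD('a) - 1 then 0
     else (- 1) ^ (CARD('a) - A) * of_nat (B choose (CARD('a) - 1 - A)))"
proof -
  let ?Q = "CARD('a) - 1"
  have "(\<Sum>y\<in>UNIV. (y::'a) ^ A * (1 - y) ^ B)
      = (\<Sum>y\<in>UNIV. \<Sum>i\<le>B. of_nat (B choose i) * (- 1) ^ i * y ^ (A + i))"
  proof (rule sum.cong)
    fix y :: 'a
    have "(1 - y) ^ B = (- y + 1) ^ B" by simp
    also have "\<dots> = (\<Sum>i\<le>B. of_nat (B choose i) * (- y) ^ i)"
      unfolding binomial_ring by simp
    finally show "y ^ A * (1 - y) ^ B = (\<Sum>i\<le>B. of_nat (B choose i) * (- 1) ^ i * y ^ (A + i))"
      by (simp add: sum_distrib_left power_add power_minus[of y] mult_ac)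
  qed simp
  also have "\<dots> = (\<Sum>i\<le>B. of_nat (B choose i) * (- 1) ^ i * (\<Sum>y\<in>UNIV. (y::'a) ^ (A + i)))"
    by (subst sum.swap) (simp add: sum_distrib_left)
  also have "\<dots> = (\<Sum>i\<le>B. of_nat (B choose i) * (- 1) ^ i * (if i = ?Q - A then - 1 else 0))"
  proof (rule sum.cong)
    fix i assume "i \<in> {..B}"
    then have "(\<Sum>y\<in>UNIV. (y::'a) ^ (A + i)) = (if A + i = ?Q then - 1 else 0)"
      by (intro finite_field_power_sum) (use assms in auto)
    moreover have "A + i = ?Q \<longleftrightarrow> i = ?Q - A" using assms(2) by auto
    ultimately show "of_nat (B choose i) * (- 1) ^ i * (\<Sum>y\<in>UNIV. (y::'a) ^ (A + i))
        = of_nat (B choose i) * (- 1) ^ i * (if i = ?Q - A then - 1 else 0)" by simp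
  qed simp
  also have "\<dots> = (\<Sum>i\<le>B. if i = ?Q - A then of_nat (B choose i) * (- 1) ^ i * - 1 else 0)"
    by (rule sum.cong) auto
  also have "\<dots> = (if A + B < ?Q then 0 else of_nat (B choose (?Q - A)) * (- 1) ^ (?Q - A) * - 1)"
    using assms(2) by (simp only: sum.delta finite_atMost) auto
  finally have "(\<Sum>y\<in>UNIV. (y::'a) ^ A * (1 - y) ^ B)
    = (if A + B < ?Q then 0 else of_nat (B choose (?Q - A)) * (- 1) ^ (?Q - A) * - 1)" .
  moreover have "CARD('a) - A = Suc (?Q - A)" using assms by linarith
  ultimately show ?thesis by (simp only: power_Suc mult_ac)
qed

section \<open>Gaussian periods of order five\<close>

lemma mod_5_cases:
  assumes "\<not> 5 dvd (k::nat)" shows "k mod 5 = 1 \<or> k mod 5 = 2 \<or> k mod 5 = 3 \<or> k mod 5 = 4"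
  using assms by (simp add: dvd_eq_mod_eq_0) presburger

text \<open>\<open>T\<close> is a nonzero linear functional over the prime field, with values represented in \<open>{0..<p}\<close>.\<close>

locale quintic_field =
  fixes p m n :: nat and \<tau> :: "'a::{field,finite}" and T :: "'a \<Rightarrow> nat"
  assumes prime_p: "prime p" and p_mod_5: "[p = 1] (mod 5)"
    and card: "CARD('a) = p ^ m" and dvd_m: "5 dvd m" and m_pos: "m > 0"
    and n: "5 * n = p ^ m - 1"
    and tau5: "\<tau> ^ 5 = 1" and tau_neq_1: "\<tau> \<noteq> 1"
    and T_less: "T x < p" and T_add: "[T (x + y) = T x + T y] (mod p)"
    and T_nonzero: "\<exists>x. T x \<noteq> 0"
begin

abbreviation q :: nat where "q \<equiv> p ^ m"

lemma p_gt_1: "p > 1" using prime_p prime_gt_1_nat by blast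

lemma char: "CHAR('a) = p" using finite_field_char card prime_p .

lemma card_minus_1: "CARD('a) - 1 = 5 * n" using card n by simp

lemma card_eq: "CARD('a) = Suc (5 * n)" using card_minus_1 zero_less_card_finite[where 'a = 'a] by linarith

lemma q_eq: "q = Suc (5 * n)" using card card_eq by simp

lemma n_pos: "n > 0"
proof (rule ccontr)
  assume "\<not> n > 0"
  then have "p ^ m = 1" by (simp only: q_eq)
  moreover have "1 < p ^ m" using p_gt_1 m_pos by (rule one_less_power)
  ultimately show False by (simp only: less_irrefl)
qed

lemma tau_power_eq_iff: "\<tau> ^ i = \<tau> ^ j \<longleftrightarrow> [i = j] (mod 5)"
proof -
  have wlog: "\<tau> ^ i = \<tau> ^ j \<longleftrightarrow> [i = j] (mod 5)" if "i \<le> j" for i j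
  proof
    assume "[i = j] (mod 5)"
    then show "\<tau> ^ i = \<tau> ^ j"
      using power_root5_mod[OF tau5, of i] power_root5_mod[OF tau5, of j] by (simp add: cong_def)
  next
    assume eq: "\<tau> ^ i = \<tau> ^ j"
    have "\<tau> \<noteq> 0" using tau5 by auto
    moreover have "\<tau> ^ i * \<tau> ^ (j - i) = \<tau> ^ i * 1"
      unfolding power_add[symmetric] le_add_diff_inverse[OF that] mult_1_right using eq by (rule sym)
    ultimately have d: "\<tau> ^ (j - i) = 1" by simp
    have "5 dvd j - i"
    proof (rule ccontr)
      assume nd: "\<not> 5 dvd j - i"
      then have "(j - i) mod 5 = 1 \<or> (j - i) mod 5 = 2 \<or> (j - i) mod 5 = 3 \<or> (j - i) mod 5 = 4"
        by (rule mod_5_cases)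
      \<comment> \<open>The exponents 1, 3, 2, 4 invert the residues 1, 2, 3, 4 modulo 5.\<close>
      then have "\<tau> = (\<tau> ^ ((j - i) mod 5)) ^ 1 \<or> \<tau> = (\<tau> ^ ((j - i) mod 5)) ^ 3 \<or>
        \<tau> = (\<tau> ^ ((j - i) mod 5)) ^ 2 \<or> \<tau> = (\<tau> ^ ((j - i) mod 5)) ^ 4"
        using power_root5_mod[OF tau5, of 6] power_root5_mod[OF tau5, of 16]
        by (auto simp flip: power_mult)
      moreover have "\<tau> ^ ((j - i) mod 5) = 1"
        using d by (simp only: power_root5_mod[OF tau5, of "j - i", symmetric])
      ultimately show False using tau_neq_1 by (simp only: power_one) simp
    qed
    then show "[i = j] (mod 5)" using mod_eq_dvd_iff_nat[OF that, of 5] by (simp add: cong_def)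
  qed
  show ?thesis
  proof (cases "i \<le> j")
    case False
    then show ?thesis
      using wlog[of j i] cong_sym_eq[of i j 5] eq_commute[of "\<tau> ^ i" "\<tau> ^ j"] by linarith
  qed (rule wlog)
qed

lemma tau_root: "1 + \<tau> + \<tau> ^ 2 + \<tau> ^ 3 + \<tau> ^ 4 = 0"
proof -
  have "(\<tau> - 1) * (1 + \<tau> + \<tau> ^ 2 + \<tau> ^ 3 + \<tau> ^ 4) = \<tau> ^ 5 - 1"
    by (simp add: algebra_simps eval_nat_numeral)
  with tau5 tau_neq_1 show ?thesis by simp
qed

lemma roots5_eq: "{y::'a. y ^ 5 = 1} = (\<lambda>i. \<tau> ^ i) ` {..<5}"
proof (rule sym, rule card_seteq)
  have "(\<tau> ^ i) ^ 5 = (\<tau> ^ 5) ^ i" for i by (simp only: mult.commute flip: power_mult)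
  then show "(\<lambda>i. \<tau> ^ i) ` {..<5} \<subseteq> {y. y ^ 5 = 1}" using tau5 by auto
  have "inj_on (\<lambda>i. \<tau> ^ i) {..<5::nat}"
    by (rule inj_onI) (auto simp: tau_power_eq_iff cong_less_modulus_unique_nat)
  then have "card ((\<lambda>i. \<tau> ^ i) ` {..<5::nat}) = 5" by (simp add: card_image)
  then show "card {y::'a. y ^ 5 = 1} \<le> card ((\<lambda>i. \<tau> ^ i) ` {..<5::nat})"
    using card_power_eq_le(2)[of 5 "1::'a"] by simp
qed simp

text \<open>The discrete logarithm of the quintic residue symbol \<open>x ^ n\<close> to the base
  \<open>\<tau>\<close>. It is meaningful for nonzero \<open>x\<close>, which is why
  \<open>fibre\<close> excludes 0.\<close>

definition idx :: "'a \<Rightarrow> nat" where "idx x = (LEAST i. x ^ n = \<tau> ^ i)"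

lemma idx: assumes "x \<noteq> 0" shows "idx x < 5" "x ^ n = \<tau> ^ idx x"
proof -
  have "(x ^ n) ^ 5 = 1"
    using finite_field_power_card_minus_1[OF assms] card_minus_1 by (simp add: mult.commute flip: power_mult)
  then obtain i where i: "i < 5" "x ^ n = \<tau> ^ i" using roots5_eq by auto
  show "x ^ n = \<tau> ^ idx x" unfolding idx_def using i(2) by (rule LeastI)
  have "idx x \<le> i" unfolding idx_def using i(2) by (rule Least_le)
  with i(1) show "idx x < 5" by simp
qed

lemma idx_eqI: assumes "x \<noteq> 0" "x ^ n = \<tau> ^ i" "i < 5" shows "idx x = i"
  using idx[OF assms(1)] assms(2,3) cong_less_modulus_unique_nat[of i "idx x" 5]
  by (simp add: tau_power_eq_iff)

lemma idx_mult: assumes "x \<noteq> 0" "y \<noteq> 0" shows "[idx (x * y) = idx x + idx y] (mod 5)"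
proof -
  have "\<tau> ^ idx (x * y) = \<tau> ^ (idx x + idx y)"
    using assms by (simp add: power_add power_mult_distrib flip: idx(2))
  then show ?thesis by (simp add: tau_power_eq_iff)
qed

lemma idx_power5: assumes "x \<noteq> 0" shows "idx (x ^ 5) = 0"
  by (rule idx_eqI) (use assms finite_field_power_card_minus_1[OF assms] card_minus_1 in \<open>auto simp flip: power_mult\<close>)

lemma idx_minus: assumes "x \<noteq> 0" shows "idx (- x) = idx x"
proof -
  have "idx (- 1 :: 'a) = 0" using idx_power5[of "- 1"] by simp
  moreover have "[idx (- 1 * x) = idx (- 1) + idx x] (mod 5)" using assms by (intro idx_mult) auto
  ultimately show ?thesis using idx(1)[of x] idx(1)[of "- x"] assms
    by (simp add: cong_less_modulus_unique_nat)
qed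

text \<open>\<open>5 * n\<close> is \<open>(p - 1) * (\<Sum>i<m. p ^ i)\<close>, and the sum is
  congruent to \<open>m\<close>, hence to 0, modulo 5. This is what makes the nonzero elements of
  the prime field fifth powers.\<close>

lemma dvd_n: "p - 1 dvd n"
proof -
  have "int p ^ m - 1 = (int p - 1) * (\<Sum>i<m. int p ^ i)" by (simp add: power_diff_1_eq)
  moreover have "[(\<Sum>i<m. int p ^ i) = (\<Sum>i<m. 1 ^ i)] (mod 5)"
    using p_mod_5 cong_int_iff[of p 1 5] by (intro cong_sum cong_pow) simp
  then have "5 dvd (\<Sum>i<m. int p ^ i)" 
    using dvd_m int_dvd_int_iff[of 5 m] by (simp add: cong_dvd_iff)
  then obtain k where "(\<Sum>i<m. int p ^ i) = 5 * k" by blast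
  moreover have "5 * int n = int p ^ m - 1" using q_eq by (simp flip: of_nat_power)
  ultimately have "int n = (int p - 1) * k" by simp
  then have "int (p - 1) dvd int n" using p_gt_1 by (simp add: of_nat_diff)
  then show ?thesis by simp
qed

lemma idx_of_nat: assumes "\<not> p dvd k" shows "idx (of_nat k) = 0"
proof (rule idx_eqI)
  show "of_nat k \<noteq> (0::'a)" using assms by (simp add: of_nat_eq_0_iff_char_dvd char)
  from dvd_n obtain d where d: "n = (p - 1) * d" by blast
  have "of_nat (k ^ (p - 1)) = (of_nat 1 :: 'a)"
    unfolding of_nat_eq_iff_cong_CHAR char by (rule fermat_theorem) (use prime_p assms in auto)
  then show "of_nat k ^ n = \<tau> ^ 0" by (simp add: d power_mult)
qed simp

definition fibre :: "nat \<Rightarrow> 'a set" where "fibre i = {x. x \<noteq> 0 \<and> idx x = i}"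

lemma fibre_union: "UNIV - {0} = (\<Union>i<5. fibre i)"
  using idx(1) by (auto simp: fibre_def)

lemma card_fibre: assumes "i < 5" shows "card (fibre i) = n"
proof -
  have le: "card (fibre j) \<le> n" for j
  proof -
    have "fibre j \<subseteq> {x. x ^ n = \<tau> ^ j}" using idx(2) by (auto simp: fibre_def)
    then have "card (fibre j) \<le> card {x. x ^ n = \<tau> ^ j}" by (intro card_mono) auto
    with card_power_eq_le(2)[OF n_pos] show ?thesis using order_trans by blast
  qed
  have "(\<Sum>j<5. card (fibre j)) = card (UNIV - {0::'a})"
    unfolding fibre_union by (rule card_UN_disjoint[symmetric]) (auto simp: fibre_def)
  also have "\<dots> = (\<Sum>j<5::nat. n)" using card_minus_1 by (simp add: card_Diff_singleton)
  finally have "(\<Sum>j<5. n - card (fibre j)) = 0"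
    using le by (subst sum_subtractf_nat) auto
  then have "n - card (fibre i) = 0" using assms by (subst (asm) sum_eq_0_iff) auto
  with le[of i] show ?thesis by simp
qed

text \<open>Taking fifth powers is at most five-to-one, so the image has at least \<open>n\<close>
  elements, enough to fill \<open>fibre 0\<close>.\<close>

lemma fifth_powers: "{x ^ 5 | x. x \<noteq> (0::'a)} = fibre 0"
proof (rule card_seteq)
  show "{x ^ 5 | x. x \<noteq> (0::'a)} \<subseteq> fibre 0" using idx_power5 by (auto simp: fibre_def)
  let ?f = "\<lambda>x::'a. x ^ 5" and ?S = "{x ^ 5 | x. x \<noteq> (0::'a)}"
  have "UNIV - {0} = (\<Union>y\<in>?S. {x. x \<noteq> 0 \<and> x ^ 5 = y})" by auto
  then have "card (UNIV - {0::'a}) = card (\<Union>y\<in>?S. {x. x \<noteq> 0 \<and> x ^ 5 = y})" by (rule arg_cong)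
  also have "\<dots> \<le> (\<Sum>y\<in>?S. card {x. x \<noteq> 0 \<and> x ^ 5 = y})" by (rule card_UN_le) simp
  also have "\<dots> \<le> (\<Sum>y\<in>?S. 5)"
  proof (rule sum_mono)
    fix y :: 'a
    have "card {x. x \<noteq> 0 \<and> x ^ 5 = y} \<le> card {x. x ^ 5 = y}" by (intro card_mono) auto
    also have "\<dots> \<le> 5" by (rule card_power_eq_le) simp
    finally show "card {x. x \<noteq> 0 \<and> x ^ 5 = y} \<le> 5" .
  qed
  finally have "n \<le> card ?S" using card_minus_1 by (simp add: card_Diff_singleton)
  then show "card (fibre 0) \<le> card ?S" by (simp add: card_fibre)
qed simp

lemma sum_fibre: "(\<Sum>x\<in>UNIV - {0}. f x) = (\<Sum>i<5. \<Sum>x\<in>fibre i. f x)"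
  unfolding fibre_union by (rule sum.UNION_disjoint) (auto simp: fibre_def)

section \<open>The additive character and the integrality of the periods\<close>

definition psi :: "'a \<Rightarrow> complex" where "psi x = cis (2 * pi / real p) ^ T x"

lemma root_p: "cis (2 * pi / real p) ^ p = 1"
  using p_gt_1 by (simp add: Complex.DeMoivre)

lemma root_p_power_cong: "[i = j] (mod p) \<Longrightarrow> cis (2 * pi / real p) ^ i = cis (2 * pi / real p) ^ j"
proof -
  have *: "cis (2 * pi / real p) ^ i = cis (2 * pi / real p) ^ (i mod p)" for i
  proof -
    have "cis (2 * pi / real p) ^ i
        = (cis (2 * pi / real p) ^ p) ^ (i div p) * cis (2 * pi / real p) ^ (i mod p)"
      by (simp only: power_mult[symmetric] power_add[symmetric] mult_div_mod_eq)
    then show ?thesis by (simp add: root_p)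
  qed
  assume "[i = j] (mod p)"
  then show ?thesis using *[of i] *[of j] by (simp only: cong_def)
qed

lemma root_p_neq_1: "cis (2 * pi / real p) \<noteq> 1"
proof
  assume eq: "cis (2 * pi / real p) = 1"
  show False
  proof (cases "p = 2")
    case False
    then have "p > 2" using p_gt_1 by simp
    then have "sin (2 * pi / real p) > 0"
      by (intro sin_gt_zero) (auto simp: field_simps)
    moreover have "Im (cis (2 * pi / real p)) = 0" by (simp only: eq one_complex.simps)
    ultimately show False by simp
  qed (use eq in simp)
qed

lemma root_p_sum: "(\<Sum>k<p. cis (2 * pi / real p) ^ k) = 0"
  using root_p root_p_neq_1 by (simp add: geometric_sum)

lemma psi_add: "psi (x + y) = psi x * psi y"
  unfolding psi_def power_add[symmetric] by (rule root_p_power_cong) (rule T_add)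

lemma psi_0 [simp]: "psi 0 = 1"
proof -
  have "psi 0 \<noteq> 0" by (simp add: psi_def)
  with psi_add[of 0 0] show ?thesis by simp
qed

lemma psi_neq_1: "\<exists>x. psi x \<noteq> 1"
proof -
  obtain x where x: "T x \<noteq> 0" using T_nonzero by blast
  have "cis (2 * pi / real p) ^ T x \<noteq> 1"
  proof
    assume 1: "cis (2 * pi / real p) ^ T x = 1"
    have "coprime (T x) p"
      using prime_p x T_less[of x] by (metis coprime_commute gr0I nat_dvd_not_less prime_imp_coprime)
    from cong_solve_coprime_nat[OF this] obtain a where a: "[T x * a = 1] (mod p)" by auto
    have "(cis (2 * pi / real p) ^ T x) ^ a = cis (2 * pi / real p) ^ 1"
      unfolding power_mult[symmetric] using a by (rule root_p_power_cong)
    with 1 root_p_neq_1 show False by simp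
  qed
  then show ?thesis by (auto simp: psi_def)
qed

lemma sum_psi: "(\<Sum>x\<in>UNIV. psi x) = 0"
proof -
  obtain y where y: "psi y \<noteq> 1" using psi_neq_1 by blast
  have "(\<Sum>x\<in>UNIV. psi x) = (\<Sum>x\<in>UNIV. psi (y + x))"
    by (rule sum.reindex_bij_witness[of _ "\<lambda>x. y + x" "\<lambda>x. x - y"]) auto
  also have "\<dots> = psi y * (\<Sum>x\<in>UNIV. psi x)" by (simp add: psi_add sum_distrib_left)
  finally have "(psi y - 1) * (\<Sum>x\<in>UNIV. psi x) = 0" by (simp add: algebra_simps)
  with y show ?thesis by simp
qed

lemma sum_psi_mult: "(\<Sum>x\<in>UNIV. psi (b * x)) = (if b = 0 then of_nat q else 0)"
proof (cases "b = 0")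
  case False
  have "(\<Sum>x\<in>UNIV. psi (b * x)) = (\<Sum>x\<in>UNIV. psi x)"
    by (rule sum.reindex_bij_witness[of _ "\<lambda>x. x / b" "\<lambda>x. b * x"]) (use False in auto)
  with False sum_psi show ?thesis by simp
qed (simp add: card)

lemma sum_psi_nonzero: "(\<Sum>x\<in>UNIV - {0}. psi x) = - 1"
  using sum_psi by (subst (asm) sum.remove[of _ 0]) (auto simp: eq_neg_iff_add_eq_0 add.commute)

lemma T_0 [simp]: "T 0 = 0"
proof -
  have "[T 0 + T 0 = T 0 + 0] (mod p)" using T_add[of 0 0] by (simp add: cong_sym)
  then have "[T 0 = 0] (mod p)" by (simp only: cong_add_lcancel_nat)
  with T_less[of 0] show ?thesis by (simp add: cong_less_modulus_unique_nat)
qed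

lemma T_of_nat_mult: "[T (of_nat k * x) = k * T x] (mod p)"
proof (induction k)
  case (Suc k)
  have "[T (of_nat k * x + x) = T (of_nat k * x) + T x] (mod p)" by (rule T_add)
  also have "[T (of_nat k * x) + T x = k * T x + T x] (mod p)"
    by (intro cong_add Suc cong_refl)
  finally show ?case by (simp add: algebra_simps)
qed simp

text \<open>The Gaussian period of class \<open>i\<close>, made an integer by definition: once the
  nonzero values of \<open>T\<close> are known to be equally frequent on the fibre, the character
  sum collapses to this difference of counts.\<close>

definition eta :: "nat \<Rightarrow> int" where
  "eta i = int (card {x \<in> fibre i. T x = 0}) - int (card {x \<in> fibre i. T x = 1})"

text \<open>Since \<open>5 dvd m\<close>, the prime field consists of fifth powers, so the fibres are stable under
  multiplication by it. Hence all nonzero values of \<open>T\<close> are taken equally often on a fibre,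
  which makes the Gaussian periods integers.\<close>

lemma card_fibre_T: assumes "0 < k" "k < p"
  shows "card {x \<in> fibre i. T x = k} = card {x \<in> fibre i. T x = 1}"
proof -
  have ndvd: "\<not> p dvd k" using assms by (simp add: nat_dvd_not_less)
  have "coprime k p" using prime_p ndvd by (metis coprime_commute prime_imp_coprime)
  from cong_solve_coprime_nat[OF this] obtain l where l: "[k * l = 1] (mod p)" by auto
  have ndvd': "\<not> p dvd l"
  proof
    assume "p dvd l"
    then have "p dvd k * l" by simp
    with l have "p dvd 1" using cong_dvd_iff by blast
    then show False using p_gt_1 by simp
  qed
  have kl: "of_nat k * of_nat l = (1::'a)"
  proof -
    have "of_nat (k * l) = (of_nat 1 :: 'a)" unfolding of_nat_eq_iff_cong_CHAR char by (rule l)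
    then show ?thesis by simp
  qed
  have step: "of_nat a * x \<in> fibre i" if "\<not> p dvd a" "x \<in> fibre i" for a x
  proof -
    have a0: "of_nat a \<noteq> (0::'a)" using that(1) by (simp add: of_nat_eq_0_iff_char_dvd char)
    have x0: "x \<noteq> 0" and xi: "idx x = i" using that(2) by (auto simp: fibre_def)
    have "[idx (of_nat a * x) = idx x] (mod 5)"
      using idx_mult[OF a0 x0] idx_of_nat[OF that(1)] by simp
    moreover have "of_nat a * x \<noteq> 0" using a0 x0 by simp
    ultimately show ?thesis
      using idx(1)[of x] idx(1)[of "of_nat a * x"] x0 xi
      by (auto simp: fibre_def cong_less_modulus_unique_nat)
  qed
  have Tk: "T (of_nat a * x) = b" if "[a * T x = b] (mod p)" "b < p" for a b x
    using T_of_nat_mult[of a x] that T_less[of "of_nat a * x"]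
    by (meson cong_less_modulus_unique_nat cong_trans)
  show ?thesis
  proof (rule bij_betw_same_card[OF bij_betw_byWitness[where f = "(*) (of_nat l)" and f' = "(*) (of_nat k)"]])
    show "\<forall>x\<in>{x \<in> fibre i. T x = k}. of_nat k * (of_nat l * x) = x"
      using kl by (simp flip: mult.assoc)
    show "\<forall>x\<in>{x \<in> fibre i. T x = 1}. of_nat l * (of_nat k * x) = x"
      using kl by (simp add: mult.left_commute flip: mult.assoc)
    show "(\<lambda>x. of_nat l * x) ` {x \<in> fibre i. T x = k} \<subseteq> {x \<in> fibre i. T x = 1}"
      using step[OF ndvd'] Tk[of l _ 1] l p_gt_1 by (auto simp: mult.commute)
    show "(\<lambda>x. of_nat k * x) ` {x \<in> fibre i. T x = 1} \<subseteq> {x \<in> fibre i. T x = k}"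
      using step[OF ndvd] Tk[of k _ k] assms by auto
  qed
qed

lemma eta: "of_int (eta i) = (\<Sum>x\<in>fibre i. psi x)"
proof -
  let ?w = "cis (2 * pi / real p)" and ?M = "\<lambda>k. card {x \<in> fibre i. T x = k}"
  have "(\<Sum>x\<in>fibre i. psi x) = (\<Sum>k<p. \<Sum>x\<in>{x \<in> fibre i. T x = k}. psi x)"
    by (rule sum.group[symmetric]) (auto simp: T_less)
  also have "\<dots> = (\<Sum>k<p. of_nat (?M k) * ?w ^ k)" by (simp add: psi_def)
  \<comment> \<open>A constant frequency \<open>?M 1\<close> would give sum 0, so only
    \<open>k = 0\<close> needs a correction term.\<close>
  also have "\<dots> = (\<Sum>k<p. of_nat (?M 1) * ?w ^ k + (if k = 0 then of_nat (?M 0) - of_nat (?M 1) else 0))"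
  proof (rule sum.cong)
    fix k assume k: "k \<in> {..<p}"
    show "of_nat (?M k) * ?w ^ k
        = of_nat (?M 1) * ?w ^ k + (if k = 0 then of_nat (?M 0) - of_nat (?M 1) else 0)"
    proof (cases "k = 0")
      case False
      then have "?M k = ?M 1" using k by (intro card_fibre_T) auto
      with False show ?thesis by (simp only: if_False add_0_right)
    qed simp
  qed simp
  also have "\<dots> = of_nat (?M 1) * (\<Sum>k<p. ?w ^ k) + (of_nat (?M 0) - of_nat (?M 1))"
    using p_gt_1 by (simp add: sum.distrib sum_distrib_left)
  finally show ?thesis by (simp add: root_p_sum eta_def)
qed

lemma sum_eta: "(\<Sum>i<5. eta i) = - 1"
proof -
  have "of_int (\<Sum>i<5. eta i) = (of_int (- 1) :: complex)"
    using sum_psi_nonzero sum_fibre[of psi] by (simp add: eta)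
  then show ?thesis by (simp only: of_int_eq_iff)
qed

end

section \<open>Gauss and Jacobi sums\<close>

context quintic_field
begin

text \<open>The value 0 at 0 is also used for the trivial characters, those with
  \<open>5 dvd j\<close>.\<close>

definition chi :: "nat \<Rightarrow> 'a \<Rightarrow> complex" where
  "chi j x = (if x = 0 then 0 else zeta5 ^ (j * idx x))"

lemma zeta5_power_cong: "[i = j] (mod 5) \<Longrightarrow> zeta5 ^ i = zeta5 ^ j"
  using power_root5_mod[OF zeta5_power_5, of i] power_root5_mod[OF zeta5_power_5, of j]
  by (simp only: cong_def)

lemma chi_0 [simp]: "chi j 0 = 0" by (simp add: chi_def)

lemma chi_mult: "chi j (x * y) = chi j x * chi j y"
proof (cases "x = 0 \<or> y = 0")
  case False
  then have "[j * idx (x * y) = j * (idx x + idx y)] (mod 5)"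
    by (intro cong_scalar_left idx_mult) auto
  from zeta5_power_cong[OF this] show ?thesis
    using False by (simp add: chi_def distrib_left power_add)
qed (auto simp: chi_def)

lemma chi_add_index: "chi (i + j) x = chi i x * chi j x"
  by (simp add: chi_def distrib_right power_add)

lemma chi_minus: "chi j (- x) = chi j x"
  by (simp add: chi_def idx_minus)

lemma sum_chi: assumes "\<not> 5 dvd j" shows "(\<Sum>x\<in>UNIV. chi j x) = 0"
proof -
  have "(\<Sum>x\<in>UNIV. chi j x) = (\<Sum>x\<in>UNIV - {0}. chi j x)"
    by (rule sum.mono_neutral_right) auto
  also have "\<dots> = (\<Sum>i<5. \<Sum>x\<in>fibre i. chi j x)" by (rule sum_fibre)
  also have "\<dots> = (\<Sum>i<5. of_nat n * (zeta5 ^ j) ^ i)"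
  proof (rule sum.cong)
    fix i :: nat assume i: "i \<in> {..<5}"
    have "(\<Sum>x\<in>fibre i. chi j x) = (\<Sum>x\<in>fibre i. (zeta5 ^ j) ^ i)"
      by (rule sum.cong) (auto simp: fibre_def chi_def power_mult)
    then show "(\<Sum>x\<in>fibre i. chi j x) = of_nat n * (zeta5 ^ j) ^ i" using i by (simp add: card_fibre)
  qed simp
  also have "\<dots> = of_nat n * (1 + zeta5 ^ j + (zeta5 ^ j) ^ 2 + (zeta5 ^ j) ^ 3 + (zeta5 ^ j) ^ 4)"
    by (simp add: eval_nat_numeral algebra_simps)
  also have "\<dots> = 0" using root5_conj[OF zeta5_root assms] by simp
  finally show ?thesis .
qed

definition gauss :: "nat \<Rightarrow> complex" where "gauss j = (\<Sum>x\<in>UNIV. chi j x * psi x)"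

definition jacobi :: "nat \<Rightarrow> nat \<Rightarrow> complex" where
  "jacobi i j = (\<Sum>y\<in>UNIV. chi i y * chi j (1 - y))"

lemma chi_convolution:
  assumes "c \<noteq> 0" shows "(\<Sum>a\<in>UNIV. chi i a * chi j (c - a)) = chi (i + j) c * jacobi i j"
proof -
  have "(\<Sum>a\<in>UNIV. chi i a * chi j (c - a)) = (\<Sum>y\<in>UNIV. chi i (c * y) * chi j (c * (1 - y)))"
    by (rule sum.reindex_bij_witness[of _ "\<lambda>y. c * y" "\<lambda>a. a / c"])
      (use assms in \<open>auto simp: right_diff_distrib\<close>)
  also have "\<dots> = chi (i + j) c * jacobi i j"
    by (simp add: chi_mult chi_add_index jacobi_def sum_distrib_left mult_ac)
  finally show ?thesis .
qed

lemma chi_convolution_0: "(\<Sum>a\<in>UNIV. chi i a * chi j (0 - a)) = (\<Sum>a\<in>UNIV. chi (i + j) a)"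
  by (simp add: chi_minus chi_add_index)

lemma gauss_mult_convolution:
  "gauss i * gauss j = (\<Sum>c\<in>UNIV. (\<Sum>a\<in>UNIV. chi i a * chi j (c - a)) * psi c)"
proof -
  have "gauss i * gauss j = (\<Sum>a\<in>UNIV. \<Sum>b\<in>UNIV. chi i a * chi j b * psi (a + b))"
    unfolding gauss_def sum_product by (simp add: psi_add mult_ac)
  also have "\<dots> = (\<Sum>a\<in>UNIV. \<Sum>c\<in>UNIV. chi i a * chi j (c - a) * psi c)"
  proof (rule sum.cong)
    fix a :: 'a
    show "(\<Sum>b\<in>UNIV. chi i a * chi j b * psi (a + b)) = (\<Sum>c\<in>UNIV. chi i a * chi j (c - a) * psi c)"
      by (rule sum.reindex_bij_witness[of _ "\<lambda>c. c - a" "\<lambda>b. a + b"]) auto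
  qed simp
  also have "\<dots> = (\<Sum>c\<in>UNIV. (\<Sum>a\<in>UNIV. chi i a * chi j (c - a)) * psi c)"
    by (subst sum.swap) (simp add: sum_distrib_right)
  finally show ?thesis .
qed

lemma gauss_mult:
  assumes "\<not> 5 dvd i + j"
  shows "gauss i * gauss j = jacobi i j * gauss (i + j)"
proof -
  have *: "(\<Sum>a\<in>UNIV. chi i a * chi j (c - a)) = chi (i + j) c * jacobi i j" for c
    using chi_convolution[of c] chi_convolution_0 sum_chi[OF assms] by (cases "c = 0") auto
  show ?thesis
    by (simp only: gauss_mult_convolution *) (simp add: gauss_def sum_distrib_left mult_ac)
qed

lemma chi_trivial: assumes "5 dvd j" shows "chi j x = (if x = 0 then 0 else 1)"
proof -
  have "[j * idx x = 0] (mod 5)" using assms by (simp add: cong_0_iff)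
  from zeta5_power_cong[OF this] show ?thesis by (simp add: chi_def)
qed

text \<open>No sign \<open>chi i (- 1)\<close> appears because -1 is a fifth power. The convolution
  is \<open>Q\<close> at 0 and a constant \<open>J\<close> elsewhere; its total over all
  \<open>c\<close> is a product of vanishing character sums, which forces
  \<open>J = - 1\<close>.\<close>

lemma gauss_mult_conj:
  assumes "\<not> 5 dvd i" "5 dvd i + j"
  shows "gauss i * gauss j = of_nat q"
proof -
  define J where "J = jacobi i j"
  define Q where "Q = (of_nat (5 * n) :: complex)"
  have S0: "(\<Sum>a\<in>UNIV. chi i a * chi j (0 - a)) = Q"
  proof -
    have "(\<Sum>a\<in>UNIV. chi (i + j) a) = (\<Sum>a\<in>UNIV - {0::'a}. 1)"
      unfolding chi_trivial[OF assms(2)] by (rule sum.mono_neutral_cong_right) auto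
    also have "\<dots> = Q" using card_minus_1 by (simp add: card_Diff_singleton Q_def)
    finally show ?thesis by (simp only: chi_convolution_0)
  qed
  have Sc: "(\<Sum>a\<in>UNIV. chi i a * chi j (c - a)) = J" if "c \<noteq> 0" for c
    using chi_convolution[OF that] that chi_trivial[OF assms(2)] by (simp add: J_def)
  \<comment> \<open>Applied with \<open>f\<close> constantly 1 to determine \<open>J\<close>, and
    with \<open>f = psi\<close> to evaluate the product of Gauss sums.\<close>
  have tot: "(\<Sum>c\<in>UNIV. (\<Sum>a\<in>UNIV. chi i a * chi j (c - a)) * f c)
      = Q * f 0 + J * (\<Sum>c\<in>UNIV - {0}. f c)" for f :: "'a \<Rightarrow> complex"
  proof -
    have "(\<Sum>c\<in>UNIV. (\<Sum>a\<in>UNIV. chi i a * chi j (c - a)) * f c) =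
      Q * f 0 + (\<Sum>c\<in>UNIV - {0}. (\<Sum>a\<in>UNIV. chi i a * chi j (c - a)) * f c)"
      by (subst sum.remove[of _ 0]) (use S0 in simp_all)
    also have "(\<Sum>c\<in>UNIV - {0}. (\<Sum>a\<in>UNIV. chi i a * chi j (c - a)) * f c) = (\<Sum>c\<in>UNIV - {0}. J * f c)"
      by (rule sum.cong) (auto simp: Sc)
    finally show ?thesis by (simp add: sum_distrib_left)
  qed
  have "Q + J * Q = (\<Sum>c\<in>UNIV. (\<Sum>a\<in>UNIV. chi i a * chi j (c - a)) * 1)"
    unfolding tot using card_minus_1 by (simp add: card_Diff_singleton Q_def)
  also have "\<dots> = (\<Sum>a\<in>UNIV. chi i a * (\<Sum>c\<in>UNIV. chi j (c - a)))"
    by (simp only: mult_1_right) (subst sum.swap, simp add: sum_distrib_left)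
  also have "\<dots> = (\<Sum>a\<in>UNIV. chi i a * (\<Sum>c\<in>UNIV. chi j c))"
  proof (rule sum.cong)
    fix a :: 'a
    have "(\<Sum>c\<in>UNIV. chi j (c - a)) = (\<Sum>c\<in>UNIV. chi j c)"
      by (rule sum.reindex_bij_witness[of _ "\<lambda>c. c + a" "\<lambda>c. c - a"]) auto
    then show "chi i a * (\<Sum>c\<in>UNIV. chi j (c - a)) = chi i a * (\<Sum>c\<in>UNIV. chi j c)" by simp
  qed simp
  also have "\<dots> = (\<Sum>a\<in>UNIV. chi i a) * (\<Sum>c\<in>UNIV. chi j c)" by (simp only: sum_distrib_right)
  also have "\<dots> = 0" using sum_chi[OF assms(1)] by simp
  finally have "Q * (1 + J) = 0" by (simp add: algebra_simps)
  moreover have "Q \<noteq> 0" using n_pos by (simp add: Q_def)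
  ultimately have "J = - 1" by (simp add: eq_neg_iff_add_eq_0 add.commute)
  moreover have "of_nat q = Q + 1" unfolding q_eq Q_def by simp
  ultimately show ?thesis
    unfolding gauss_mult_convolution tot using sum_psi_nonzero by simp
qed

lemma gauss_power5: "gauss 1 ^ 5 = of_nat q * jacobi 1 1 ^ 2 * jacobi 1 2"
proof -
  have e: "1 + 1 = (2::nat)" "1 + 2 = (3::nat)" by simp_all
  have 1: "gauss 1 * gauss 1 = jacobi 1 1 * gauss 2" by (rule gauss_mult[of 1 1, unfolded e]) simp
  have 2: "gauss 1 * gauss 2 = jacobi 1 2 * gauss 3" by (rule gauss_mult[of 1 2, unfolded e]) simp
  have 3: "gauss 2 * gauss 3 = of_nat q" using gauss_mult_conj[of 2 3] by simp
  have "gauss 1 ^ 5 = (gauss 1 * gauss 1) * (gauss 1 * gauss 1) * gauss 1"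
    by (simp add: eval_nat_numeral)
  also have "\<dots> = jacobi 1 1 ^ 2 * gauss 2 * (gauss 1 * gauss 2)"
    unfolding 1 by (simp add: power2_eq_square)
  also have "\<dots> = jacobi 1 1 ^ 2 * jacobi 1 2 * (gauss 2 * gauss 3)"
    unfolding 2 by simp
  finally show ?thesis unfolding 3 by (simp add: mult_ac)
qed

text \<open>The factor 4 stands for -1, that is, for complex conjugation. A Jacobi sum is a quotient
  of Gauss sums, each having product \<open>q\<close> with its conjugate, so the value is
  \<open>q * q / q\<close>.\<close>

lemma jacobi_norm:
  assumes "\<not> 5 dvd i" "\<not> 5 dvd j" "\<not> 5 dvd i + j"
  shows "jacobi i j * jacobi (4 * i) (4 * j) = of_nat q"
proof -
  have q0: "of_nat q \<noteq> (0::complex)" using p_gt_1 by simp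
  have c: "\<not> 5 dvd 4 * i + 4 * j" using assms(3) by presburger
  have g: "gauss k * gauss (4 * k) = of_nat q" if "\<not> 5 dvd k" for k
    by (rule gauss_mult_conj) (use that in auto)
  have "(jacobi i j * jacobi (4 * i) (4 * j)) * (gauss (i + j) * gauss (4 * (i + j)))
      = (gauss i * gauss (4 * i)) * (gauss j * gauss (4 * j))"
    using gauss_mult[OF assms(3)] gauss_mult[OF c] by (simp add: distrib_left mult_ac)
  then show ?thesis unfolding g[OF assms(1)] g[OF assms(2)] g[OF assms(3)]
    using q0 by (simp only: mult_cancel_right) blast
qed

section \<open>Polynomial representatives of Gauss and Jacobi sums and their reductions\<close>

definition gpoly :: "int poly" where "gpoly = (\<Sum>i<5. Polynomial.monom (eta i) i)"

text \<open>The points 0 and 1 are left out because a character factor vanishes there and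
  \<open>idx\<close> has no meaning at 0.\<close>

definition jpoly :: "nat \<Rightarrow> nat \<Rightarrow> int poly" where
  "jpoly a b = (\<Sum>y\<in>UNIV - {0, 1}. Polynomial.monom 1 (a * idx y + b * idx (1 - y)))"

lemma eval_gpoly: "eval_int_poly gpoly (zeta5 ^ j) = gauss j"
proof -
  have "gauss j = (\<Sum>x\<in>UNIV - {0}. chi j x * psi x)"
    unfolding gauss_def by (rule sum.mono_neutral_right) auto
  also have "\<dots> = (\<Sum>i<5. \<Sum>x\<in>fibre i. chi j x * psi x)" by (rule sum_fibre)
  also have "\<dots> = (\<Sum>i<5. \<Sum>x\<in>fibre i. (zeta5 ^ j) ^ i * psi x)"
    by (intro sum.cong) (auto simp: fibre_def chi_def power_mult)
  also have "\<dots> = (\<Sum>i<5. of_int (eta i) * (zeta5 ^ j) ^ i)"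
    by (simp add: eta sum_distrib_left mult_ac)
  finally show ?thesis by (simp add: gpoly_def)
qed

lemma eval_jpoly: "eval_int_poly (jpoly a b) (zeta5 ^ j) = jacobi (j * a) (j * b)"
proof -
  have "jacobi (j * a) (j * b) = (\<Sum>y\<in>UNIV - {0, 1}. chi (j * a) y * chi (j * b) (1 - y))"
    unfolding jacobi_def by (rule sum.mono_neutral_right) auto
  also have "\<dots> = (\<Sum>y\<in>UNIV - {0, 1}. (zeta5 ^ j) ^ (a * idx y + b * idx (1 - y)))"
    by (intro sum.cong) (auto simp: chi_def power_add power_mult mult.assoc)
  finally show ?thesis by (simp add: jpoly_def)
qed

text \<open>When \<open>zeta5\<close> is sent to \<open>\<tau>\<close>, the quintic character
  becomes the power map \<open>y ^ n\<close>, so the Jacobi sum turns into a power sum inside the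
  field itself.\<close>

lemma of_int_eval_jpoly:
  assumes t: "of_int t = \<tau>" and "a mod 5 = A" "A > 0" "b mod 5 = B" "B > 0"
  shows "of_int (eval_int_poly (jpoly a b) t) =
    (if A + B < 5 then 0 else (- 1) ^ (CARD('a) - n * A) * of_nat ((B * n) choose ((5 - A) * n)) :: 'a)"
proof -
  have AB: "A < 5" "B < 5" using assms by auto
  have pw: "\<tau> ^ (c * idx y) = y ^ (n * C)" if "y \<noteq> 0" "c mod 5 = C" for c C y
  proof -
    have "\<tau> ^ (c * idx y) = \<tau> ^ (C * idx y)"
      unfolding tau_power_eq_iff using that(2) by (auto simp: cong_def mod_mult_left_eq)
    also have "\<dots> = (\<tau> ^ idx y) ^ C" by (simp add: mult.commute flip: power_mult)
    also have "\<dots> = y ^ (n * C)" using idx(2)[OF that(1)] by (simp add: power_mult)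
    finally show ?thesis .
  qed
  have "of_int (eval_int_poly (jpoly a b) t)
      = (\<Sum>y\<in>UNIV - {0, 1}. \<tau> ^ (a * idx y) * \<tau> ^ (b * idx (1 - y)))"
    unfolding of_int_eval_int_poly t by (simp add: jpoly_def power_add)
  also have "\<dots> = (\<Sum>y\<in>UNIV - {0, 1}. y ^ (n * A) * (1 - y) ^ (n * B))"
    by (intro sum.cong refl arg_cong2[where f = "(*)"] pw assms) auto
  also have "\<dots> = (\<Sum>y\<in>UNIV. y ^ (n * A) * (1 - y) ^ (n * B))"
    by (rule sum.mono_neutral_left) (use n_pos assms in auto)
  also have "\<dots> = (if n * A + n * B < CARD('a) - 1 then 0
     else (- 1) ^ (CARD('a) - n * A) * of_nat ((n * B) choose (CARD('a) - 1 - n * A)))"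
  proof (rule finite_field_jacobi_power_sum)
    show "n * A \<le> CARD('a) - 1" unfolding card_minus_1 using AB n_pos by simp
    have "n * (A + B) < n * 10" using AB n_pos by (intro mult_strict_left_mono) auto
    then show "n * A + n * B < 2 * (CARD('a) - 1)" unfolding card_minus_1 by (simp add: algebra_simps)
  qed (use n_pos assms in simp)
  also have "n * A + n * B < CARD('a) - 1 \<longleftrightarrow> A + B < 5"
  proof -
    have "n * A + n * B < CARD('a) - 1 \<longleftrightarrow> n * (A + B) < n * 5"
      unfolding card_minus_1 by (simp only: distrib_left mult.commute)
    then show ?thesis using n_pos by simp
  qed
  also have "CARD('a) - 1 - n * A = (5 - A) * n"
    unfolding card_minus_1 by (simp only: diff_mult_distrib mult.commute[of n A])
  finally show ?thesis by (simp only: mult.commute)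
qed

lemma eval_jpoly_mod_p:
  assumes t: "of_int t = \<tau>" and A: "a mod 5 = A" "A > 0" and B: "b mod 5 = B" "B > 0"
  shows "int p dvd eval_int_poly (jpoly a b) t \<longleftrightarrow> A + B < 5"
proof -
  have "int p dvd eval_int_poly (jpoly a b) t \<longleftrightarrow> of_int (eval_int_poly (jpoly a b) t) = (0::'a)"
    by (simp add: of_int_eq_0_iff_char_dvd char)
  moreover have "\<not> p dvd ((B * n) choose ((5 - A) * n))" if "\<not> A + B < 5"
  proof -
    \<comment> \<open>With \<open>p = 5 * c + 1\<close>, all \<open>m\<close> base-\<open>p\<close>
      digits of \<open>n\<close> are equal to \<open>c\<close>, and \<open>B * c < p\<close>
      excludes carries.\<close>
    obtain c where c: "p = 5 * c + 1"
      using p_mod_5 p_gt_1 by (metis cong_to_1_nat dvdE le_add_diff_inverse2 less_imp_le_nat)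
    have "int p ^ m - 1 = (int p - 1) * (\<Sum>i<m. int p ^ i)" by (simp add: power_diff_1_eq)
    moreover have "5 * int n = int p ^ m - 1" using q_eq by (simp flip: of_nat_power)
    ultimately have "int n = int (c * (\<Sum>i<m. p ^ i))" by (simp add: c)
    then have "n = c * (\<Sum>i<m. p ^ i)" by (simp only: of_nat_eq_iff)
    moreover have "B * c < p"
    proof -
      have "B * c \<le> 5 * c" using B mod_less_divisor[of 5 b] by (intro mult_le_mono1) simp
      then show ?thesis using c by linarith
    qed
    ultimately show ?thesis
      using that prime_p by (intro prime_not_dvd_choose_repdigit) auto
  qed
  ultimately show ?thesis
    unfolding of_int_eval_jpoly[OF assms] by (auto simp: of_nat_eq_0_iff_char_dvd char)
qed

end

context quintic_field
begin

lemma eval_jpoly_power: "eval_int_poly (jpoly a b) (z ^ j) = eval_int_poly (jpoly (j * a) (j * b)) z"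
  unfolding jpoly_def eval_int_poly_sum eval_int_poly_monom power_mult[symmetric]
  by (simp only: distrib_left mult.assoc)

text \<open>The Jacobi sums at \<open>j\<close> and \<open>4 * j\<close> have product
  \<open>q\<close>; the hypothesis \<open>unit\<close> makes the second one prime to
  \<open>p\<close>, so the first one carries all of \<open>p ^ m\<close>.\<close>

lemma eval_jpoly_power_dvd:
  assumes t: "of_int t = \<tau>" and root: "int p ^ N dvd eval_int_poly cyclo5 t" and "m \<le> N"
    and "\<not> 5 dvd a" "\<not> 5 dvd b" "\<not> 5 dvd a + b" "\<not> 5 dvd j"
    and unit: "(4 * j * a) mod 5 + (4 * j * b) mod 5 \<ge> 5"
  shows "int p ^ m dvd eval_int_poly (jpoly a b) (t ^ j)"
proof -
  have pr: "prime (5::nat)" by simp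
  have nd: "\<not> 5 dvd j * a" "\<not> 5 dvd j * b" "\<not> 5 dvd j * a + j * b"
    using assms(4-7) prime_dvd_mult_iff[OF pr] by (auto simp flip: distrib_left)
  have nd4: "\<not> 5 dvd 4 * j * a" "\<not> 5 dvd 4 * j * b"
    using nd(1,2) prime_dvd_mult_iff[OF pr] by (simp_all only: mult.assoc) auto
  define P where "P = pcompose (jpoly a b) (Polynomial.monom 1 j) * pcompose (jpoly a b) (Polynomial.monom 1 (4 * j))"
  have "eval_int_poly P zeta5 = eval_int_poly [:int q:] zeta5"
    using jacobi_norm[OF nd] unfolding P_def eval_int_poly_mult eval_int_poly_pcompose_monom eval_jpoly
    by (simp add: mult.assoc)
  from eval_int_poly_zeta5_transfer[OF this root]
  have "[eval_int_poly P t = int p ^ m] (mod int p ^ N)" by simp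
  then have "[eval_int_poly P t = int p ^ m] (mod int p ^ m)"
    by (rule cong_dvd_modulus) (use assms(3) in \<open>rule le_imp_power_dvd\<close>)
  then have "int p ^ m dvd eval_int_poly P t" by (simp add: cong_iff_dvd_diff dvd_diff_left_iff)
  then have "int p ^ m dvd eval_int_poly (jpoly a b) (t ^ j) * eval_int_poly (jpoly (4 * j * a) (4 * j * b)) t"
    unfolding P_def eval_int_poly_mult eval_int_poly_pcompose_monom eval_jpoly_power .
  moreover have "\<not> int p dvd eval_int_poly (jpoly (4 * j * a) (4 * j * b)) t"
    using eval_jpoly_mod_p[OF t refl _ refl _, of "4 * j * a" "4 * j * b"] nd4 unit
    by (simp only: dvd_eq_mod_eq_0 neq0_conv not_less)
  then have "coprime (int p ^ m) (eval_int_poly (jpoly (4 * j * a) (4 * j * b)) t)"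
    using prime_p by (simp add: prime_imp_coprime)
  ultimately show ?thesis by (simp add: coprime_dvd_mult_left_iff)
qed

text \<open>In \<open>q * J1 ^ 2 * J2\<close>, the fifth power of the Gauss sum, one counts at least
  4, 3, 2, 1 factors \<open>q\<close> at \<open>t ^ j\<close> for \<open>j\<close> = 1, 2, 3, 4. As
  \<open>q\<close> is the fifth power of \<open>p ^ s\<close>, fifth roots can be taken. The largest
  count explains the precision \<open>4 * m\<close>.\<close>

lemma gpoly_divisible:
  assumes t: "of_int t = \<tau>" and root: "int p ^ (4 * m) dvd eval_int_poly cyclo5 t"
    and m: "m = 5 * s" and j: "j \<in> {1..4}"
  shows "(int p ^ s) ^ (5 - j) dvd eval_int_poly gpoly (t ^ j)"
proof -
  define G where "G = eval_int_poly gpoly (t ^ j)"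
  define J1 where "J1 = eval_int_poly (jpoly 1 1) (t ^ j)"
  define J2 where "J2 = eval_int_poly (jpoly 1 2) (t ^ j)"
  define Q where "Q = int p ^ m"
  have j': "j = 1 \<or> j = 2 \<or> j = 3 \<or> j = 4" using j by auto
  have nd: "\<not> 5 dvd j" using j' by auto
  have root': "int p ^ (4 * m) dvd eval_int_poly cyclo5 (t ^ j)"
    using root nd by (rule cyclo5_dvd_conj)
  have "eval_int_poly (gpoly ^ 5) zeta5 = eval_int_poly ([:Q:] * jpoly 1 1 ^ 2 * jpoly 1 2) zeta5"
    using gauss_power5 eval_gpoly[of 1] eval_jpoly[of 1 1 1] eval_jpoly[of 1 2 1]
    by (simp add: Q_def)
  from eval_int_poly_zeta5_transfer[OF this root']
  have "[G ^ 5 = Q * J1 ^ 2 * J2] (mod int p ^ (4 * m))" by (simp add: G_def J1_def J2_def mult.assoc)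
  moreover have "int p ^ (4 * m) = Q ^ 4" by (simp add: Q_def mult.commute flip: power_mult)
  ultimately have "[G ^ 5 = Q * J1 ^ 2 * J2] (mod Q ^ 4)" by simp
  then have cong: "[G ^ 5 = Q * J1 ^ 2 * J2] (mod Q ^ (5 - j))"
    by (rule cong_dvd_modulus) (use j in \<open>auto intro!: le_imp_power_dvd\<close>)
  have D: "Q dvd eval_int_poly (jpoly a b) (t ^ j)"
    if "\<not> 5 dvd a" "\<not> 5 dvd b" "\<not> 5 dvd a + b" "(4 * j * a) mod 5 + (4 * j * b) mod 5 \<ge> 5" for a b
    unfolding Q_def by (rule eval_jpoly_power_dvd[OF t root _ that(1-3) nd that(4)]) simp
  have nd5: "\<not> 5 dvd (1::nat)" "\<not> 5 dvd (2::nat)" "\<not> 5 dvd (1 + 1::nat)" "\<not> 5 dvd (1 + 2::nat)"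
    by presburger+
  note D1 = D[OF nd5(1,1,3), folded J1_def] and D2 = D[OF nd5(1,2,4), folded J2_def]
  have "Q ^ (5 - j) dvd Q * J1 ^ 2 * J2"
    using j'
  proof (elim disjE)
    assume j: "j = 1"
    have "Q dvd J1" "Q dvd J2" by (rule D1 D2; simp add: j)+
    then have "Q * Q ^ 2 * Q dvd Q * J1 ^ 2 * J2" by (intro mult_dvd_mono dvd_power_same dvd_refl)
    then show ?thesis by (simp add: j eval_nat_numeral)
  next
    assume j: "j = 2"
    have "Q dvd J1" by (rule D1) (simp add: j)
    then have "Q * Q ^ 2 * 1 dvd Q * J1 ^ 2 * J2" by (intro mult_dvd_mono dvd_power_same dvd_refl one_dvd)
    then show ?thesis by (simp add: j eval_nat_numeral)
  next
    assume j: "j = 3"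
    have "Q dvd J2" by (rule D2) (simp add: j)
    then have "Q * 1 * Q dvd Q * J1 ^ 2 * J2" by (intro mult_dvd_mono dvd_refl one_dvd)
    then show ?thesis by (simp add: j eval_nat_numeral)
  qed simp
  then have "Q ^ (5 - j) dvd G ^ 5" by (simp only: cong_dvd_iff[OF cong])
  moreover have "Q ^ (5 - j) = ((int p ^ s) ^ (5 - j)) ^ 5"
    by (simp add: Q_def m mult_ac flip: power_mult)
  ultimately show ?thesis unfolding G_def by simp
qed

lemma eval_gpoly_norm:
  assumes "\<not> 5 dvd j" shows "eval_int_poly gpoly (zeta5 ^ j) * eval_int_poly gpoly (zeta5 ^ (4 * j)) = of_nat q"
  unfolding eval_gpoly by (rule gauss_mult_conj) (use assms in auto)

lemma eval_gpoly_1: "eval_int_poly gpoly (1::int) = - 1"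
  using sum_eta by (simp add: gpoly_def)

lemma eta_trace:
  assumes "i < 5"
  shows "(\<Sum>j=1..4. zeta5 ^ (j * (5 - i)) * eval_int_poly gpoly (zeta5 ^ j)) = 5 * of_int (eta i) + 1"
proof -
  have "eval_int_poly gpoly (zeta5 ^ j) = (\<Sum>i<5. of_int (eta i) * zeta5 ^ (i * j))" for j
    by (simp add: gpoly_def mult.commute flip: power_mult)
  moreover have "(\<Sum>i<5. of_int (eta i)) = (- 1 :: complex)"
    using sum_eta by (metis of_int_1 of_int_minus of_int_sum)
  ultimately show ?thesis using root5_trace[OF zeta5_root assms, of "\<lambda>i. of_int (eta i)"] by simp
qed

end

section \<open>The quadratic system\<close>

lemma root5_table:
  fixes z :: "'r::comm_ring_1"
  assumes z5: "z ^ 5 = 1"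
  shows "z * z = z ^ 2" "z * z ^ 2 = z ^ 3" "z * z ^ 3 = z ^ 4" "z * z ^ 4 = 1"
    "z ^ 2 * z ^ 2 = z ^ 4" "z ^ 2 * z ^ 3 = 1" "z ^ 2 * z ^ 4 = z"
    "z ^ 3 * z ^ 3 = z" "z ^ 3 * z ^ 4 = z ^ 2" "z ^ 4 * z ^ 4 = z ^ 3"
proof -
  have *: "z ^ i * z ^ j = z ^ ((i + j) mod 5)" for i j
    unfolding power_add[symmetric] by (rule power_root5_mod[OF z5])
  show "z * z = z ^ 2" "z * z ^ 2 = z ^ 3" "z * z ^ 3 = z ^ 4" "z * z ^ 4 = 1"
    using *[of 1 1] *[of 1 2] *[of 1 3] *[of 1 4] by (simp_all add: power2_eq_square)
  show "z ^ 2 * z ^ 2 = z ^ 4" "z ^ 2 * z ^ 3 = 1" "z ^ 2 * z ^ 4 = z"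
    "z ^ 3 * z ^ 3 = z" "z ^ 3 * z ^ 4 = z ^ 2" "z ^ 4 * z ^ 4 = z ^ 3"
    unfolding * by simp_all
qed

lemma root5_mult:
  fixes z :: "'r::comm_ring_1"
  assumes z5: "z ^ 5 = 1"
  shows "(b0 + b1 * z + b2 * z ^ 2 + b3 * z ^ 3 + b4 * z ^ 4) * (d0 + d1 * z + d2 * z ^ 2 + d3 * z ^ 3 + d4 * z ^ 4)
      = (b0 * d0 + b1 * d4 + b2 * d3 + b3 * d2 + b4 * d1) + (b0 * d1 + b1 * d0 + b2 * d4 + b3 * d3 + b4 * d2) * z
      + (b0 * d2 + b1 * d1 + b2 * d0 + b3 * d4 + b4 * d3) * z ^ 2 + (b0 * d3 + b1 * d2 + b2 * d1 + b3 * d0 + b4 * d4) * z ^ 3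
      + (b0 * d4 + b1 * d3 + b2 * d2 + b3 * d1 + b4 * d0) * z ^ 4"
proof -
  define y2 y3 y4 where "y2 = z ^ 2" and "y3 = z ^ 3" and "y4 = z ^ 4"
  note t = root5_table[OF z5, folded y2_def y3_def y4_def]
  show ?thesis unfolding y2_def[symmetric] y3_def[symmetric] y4_def[symmetric]
    by (simp add: algebra_simps t t(2-4,6,7,9)[THEN trans[OF mult.commute]])
qed

text \<open>\<open>e\<close> is the quadratic Gauss sum. Both \<open>z - z ^ 4\<close> and
  \<open>z ^ 2 - z ^ 3\<close> change sign under \<open>z \<mapsto> z ^ 4\<close>, so their products
  are invariant and become linear in \<open>e\<close>.\<close>

lemma root5_quadratic:
  fixes z :: "'r::comm_ring_1"
  defines "e \<equiv> z - z ^ 2 - z ^ 3 + z ^ 4"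
  assumes z: "1 + z + z ^ 2 + z ^ 3 + z ^ 4 = 0"
  shows "e * e = 5" "2 * ((z - z ^ 4) * (z - z ^ 4)) = - 5 - e"
    "2 * ((z ^ 2 - z ^ 3) * (z ^ 2 - z ^ 3)) = - 5 + e" "(z - z ^ 4) * (z ^ 2 - z ^ 3) = - e"
proof -
  note t = root5_table[OF root5_power[OF z]]
  define y2 y3 y4 where "y2 = z ^ 2" and "y3 = z ^ 3" and "y4 = z ^ 4"
  note t = t[folded y2_def y3_def y4_def]
  note t' = t t(2-4,6,7,9)[THEN trans[OF mult.commute]]
  have e: "e = z - y2 - y3 + y4" by (simp add: e_def y2_def y3_def y4_def)
  have z: "1 + z + y2 + y3 + y4 = 0" using z by (simp add: y2_def y3_def y4_def)
  have "e * e = 5 - (1 + z + y2 + y3 + y4)"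
    unfolding e by (simp add: algebra_simps t')
  then show "e * e = 5" by (simp add: z)
  have "2 * ((z - y4) * (z - y4)) = - 5 - e + (1 + z + y2 + y3 + y4)"
    unfolding e by (simp add: algebra_simps t')
  then show "2 * ((z - z ^ 4) * (z - z ^ 4)) = - 5 - e" by (simp add: z flip: y4_def)
  have "2 * ((y2 - y3) * (y2 - y3)) = - 5 + e + (1 + z + y2 + y3 + y4)"
    unfolding e by (simp add: algebra_simps t')
  then show "2 * ((z ^ 2 - z ^ 3) * (z ^ 2 - z ^ 3)) = - 5 + e" by (simp add: z flip: y2_def y3_def)
  have "(z - y4) * (y2 - y3) = - e"
    unfolding e by (simp add: algebra_simps t')
  then show "(z - z ^ 4) * (z ^ 2 - z ^ 3) = - e" by (simp only: y2_def y3_def y4_def)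
qed

lemma int_square_mod_8: "odd (k::int) \<Longrightarrow> \<exists>j. k ^ 2 = 8 * j + 1"
proof (elim oddE)
  fix l assume k: "k = 2 * l + 1"
  have "even (l * (l + 1))" by simp
  then obtain j where "l * (l + 1) = 2 * j" by blast
  then have "k ^ 2 = 8 * j + 1" unfolding k by (simp add: power2_eq_square algebra_simps)
  then show ?thesis by blast
qed

locale quintic_solution =
  fixes r x w v u :: int
  assumes norm: "16 * r = x^2 + 125 * w^2 + 50 * v^2 + 50 * u^2"
    and rel: "x * w = v^2 - 4 * u * v - u^2"
begin

text \<open>These conditions make the element constructed below divisible by 4. They come from
  reading both equations modulo powers of 2, where odd squares are 1 modulo 8.\<close>

lemma parity: "even (w + u + v)" "4 dvd x - w - 2 * u"
proof -
  have "even (x ^ 2 + 125 * w ^ 2 + 50 * v ^ 2 + 50 * u ^ 2)" unfolding norm[symmetric] by simp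
  then have xw: "even x \<longleftrightarrow> even w" by auto
  have "even (w + u + v) \<and> 4 dvd x - w - 2 * u"
  proof (cases "even w")
    case True
    then obtain a b where a: "x = 2 * a" and b: "w = 2 * b" using xw by (auto elim!: evenE)
    have ab: "4 * (a * b) = v^2 - 4 * u * v - u^2" using rel by (simp add: a b)
    have "even (4 * (a * b))" by simp
    then have vu: "even v \<longleftrightarrow> even u" unfolding ab by auto
    have "even u"
    proof (rule ccontr)
      assume u: "odd u"
      then have v: "odd v" using vu by simp
      obtain j k where j: "u ^ 2 = 8 * j + 1" and k: "v ^ 2 = 8 * k + 1"
        using int_square_mod_8 u v by blast
      obtain u' v' where u': "u = 2 * u' + 1" and v': "v = 2 * v' + 1" using u v by (auto elim!: oddE)
      \<comment> \<open>Odd \<open>u\<close> and \<open>v\<close> force \<open>a\<close> and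
        \<open>b\<close> to be odd, and then the norm equation divided by 4 equates the even number
        \<open>4 * r\<close> with an odd one.\<close>
      have "a * b = 2 * (k - j - 2 * u' * v' - u' - v') - 1"
        using ab unfolding j k by (simp add: u' v' algebra_simps)
      then have "odd (a * b)" by simp
      then have "odd a" "odd b" by auto
      then obtain a' b' where a': "a ^ 2 = 8 * a' + 1" and b': "b ^ 2 = 8 * b' + 1"
        using int_square_mod_8 by blast
      have "16 * r = 4 * (8 * a' + 1) + 500 * (8 * b' + 1) + 50 * (8 * k + 1) + 50 * (8 * j + 1)"
        using norm unfolding a b power_mult_distrib a' b' j k by simp
      then have "4 * r = 2 * (4 * a' + 500 * b' + 50 * k + 50 * j + 75) + 1" by simp
      then have "odd (4 * r)" by simp
      then show False by simp
    qed
    then obtain u' v' where u': "u = 2 * u'" and v': "v = 2 * v'" using vu by (auto elim!: evenE)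
    have "4 * r = a ^ 2 + 125 * b ^ 2 + 50 * v' ^ 2 + 50 * u' ^ 2"
      using norm unfolding a b u' v' power_mult_distrib by simp
    moreover have "even (4 * r)" by simp
    ultimately have "even a \<longleftrightarrow> even b" by auto
    then have "even (a - b)" by simp
    then obtain d where "a - b = 2 * d" by blast
    then have "x - w - 2 * u = 4 * (d - u')" by (simp add: a b u')
    then show ?thesis by (simp add: b u' v')
  next
    case w: False
    then have x: "odd x" using xw by simp
    then have "odd (x * w)" using w by simp
    then have uv: "odd (u + v)" unfolding rel by auto
    obtain a b where a: "x = 2 * a + 1" and b: "w = 2 * b + 1" using w x by (auto elim!: oddE)
    have "4 dvd x - w - 2 * u"
    proof (cases "even u")
      case True
      then obtain u' where u': "u = 2 * u'" by blast
      have "odd v" using uv True by simp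
      then obtain k where k: "v ^ 2 = 8 * k + 1" using int_square_mod_8 by blast
      have "2 * (2 * (a * b) + a + b) = 8 * k - 8 * (u' * v) - 4 * u' ^ 2"
        using rel unfolding k by (simp add: a b u' power_mult_distrib algebra_simps)
      then have "a + b = 2 * (2 * k - 2 * (u' * v) - u' ^ 2 - a * b)" by simp
      then have "x - w - 2 * u = 4 * ((2 * k - 2 * (u' * v) - u' ^ 2 - a * b) - b - u')"
        by (simp add: a b u')
      then show ?thesis by simp
    next
      case False
      then obtain u' where u': "u = 2 * u' + 1" by (auto elim!: oddE)
      obtain v' where v': "v = 2 * v'" using uv False by (auto elim!: evenE)
      obtain k where k: "u ^ 2 = 8 * k + 1" using int_square_mod_8 False by blast
      have "2 * (2 * (a * b) + a + b) = 4 * v' ^ 2 - 8 * (u * v') - 8 * k - 2"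
        using rel unfolding k by (simp add: a b v' power_mult_distrib algebra_simps)
      then have "a + b = 2 * (v' ^ 2 - 2 * (u * v') - 2 * k - a * b) - 1" by simp
      then have "x - w - 2 * u = 4 * ((v' ^ 2 - 2 * (u * v') - 2 * k - a * b) - b - u' - 1)"
        by (simp add: a b u')
      then show ?thesis by simp
    qed
    then show ?thesis using uv w by simp
  qed
  then show "even (w + u + v)" "4 dvd x - w - 2 * u" by blast+
qed

text \<open>With \<open>\<epsilon> = z - z\<^sup>2 - z\<^sup>3 + z\<^sup>4\<close>, a square root of 5, the system says that
  \<open>x + 5w\<epsilon> + (4v + 2u)(z - z\<^sup>4) + (4u - 2v)(z\<^sup>2 - z\<^sup>3)\<close> has absolute value \<open>4\<surd>r\<close> at all conjugates.
  This element is divisible by 4 in \<open>\<int>[z]\<close>; below, \<open>x(1 + z + z\<^sup>2 + z\<^sup>3 + z\<^sup>4) = 0\<close> is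
  subtracted from it in order to make its coefficients divisible by 4. The map \<^const>\<open>quintic_sigma\<close>
  corresponds to \<open>z \<mapsto> z\<^sup>2\<close>.\<close>

definition c1 :: int where "c1 = (5 * w + 4 * v + 2 * u - x) div 4"
definition c2 :: int where "c2 = (- 5 * w - 2 * v + 4 * u - x) div 4"
definition c3 :: int where "c3 = (- 5 * w + 2 * v - 4 * u - x) div 4"
definition c4 :: int where "c4 = (5 * w - 4 * v - 2 * u - x) div 4"

lemma four_c:
  "4 * c1 = 5 * w + 4 * v + 2 * u - x"
  "4 * c2 = - 5 * w - 2 * v + 4 * u - x"
  "4 * c3 = - 5 * w + 2 * v - 4 * u - x"
  "4 * c4 = 5 * w - 4 * v - 2 * u - x"
proof -
  from parity obtain a b where "w + u + v = 2 * a" and "x - w - 2 * u = 4 * b" by blast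
  then have u: "v = 2 * a - w - u" and x: "x = w + 2 * u + 4 * b" by linarith+
  have "4 dvd 5 * w + 4 * v + 2 * u - x" "4 dvd - 5 * w - 2 * v + 4 * u - x"
    "4 dvd - 5 * w + 2 * v - 4 * u - x" "4 dvd 5 * w - 4 * v - 2 * u - x"
    unfolding u x by presburger+
  then show "4 * c1 = 5 * w + 4 * v + 2 * u - x" "4 * c2 = - 5 * w - 2 * v + 4 * u - x"
    "4 * c3 = - 5 * w + 2 * v - 4 * u - x" "4 * c4 = 5 * w - 4 * v - 2 * u - x"
    unfolding c1_def c2_def c3_def c4_def by simp_all
qed

definition spoly :: "int poly" where "spoly = [:0, c1, c2, c3, c4:]"

lemma four_eval_spoly:
  fixes z :: "'r::comm_ring_1"
  assumes z: "1 + z + z ^ 2 + z ^ 3 + z ^ 4 = 0"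
  shows "4 * eval_int_poly spoly z = of_int x + of_int (5 * w + 4 * v + 2 * u) * z
    + of_int (- 5 * w - 2 * v + 4 * u) * z ^ 2 + of_int (- 5 * w + 2 * v - 4 * u) * z ^ 3
    + of_int (5 * w - 4 * v - 2 * u) * z ^ 4"
proof -
  have "4 * eval_int_poly spoly z
      = of_int (4 * c1) * z + of_int (4 * c2) * z ^ 2 + of_int (4 * c3) * z ^ 3 + of_int (4 * c4) * z ^ 4"
    by (simp add: spoly_def algebra_simps eval_nat_numeral)
  also have "\<dots> = of_int x + of_int (5 * w + 4 * v + 2 * u) * z
    + of_int (- 5 * w - 2 * v + 4 * u) * z ^ 2 + of_int (- 5 * w + 2 * v - 4 * u) * z ^ 3
    + of_int (5 * w - 4 * v - 2 * u) * z ^ 4 - of_int x * (1 + z + z ^ 2 + z ^ 3 + z ^ 4)"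
    unfolding four_c by (simp add: algebra_simps)
  finally show ?thesis using z by simp
qed

text \<open>Conjugation \<open>z \<mapsto> z ^ 4\<close> fixes \<open>X + 5 * W * e\<close> and
  negates the rest of \<open>4 * S\<close>. In the resulting difference of squares,
  \<open>rel\<close> cancels the coefficient of \<open>e\<close> and \<open>norm\<close> gives the
  constant term.\<close>

lemma eval_spoly_norm:
  assumes z: "1 + z + z ^ 2 + z ^ 3 + z ^ 4 = (0::complex)"
  shows "eval_int_poly spoly z * eval_int_poly spoly (z ^ 4) = of_int r"
proof -
  have z': "1 + z ^ 4 + (z ^ 4) ^ 2 + (z ^ 4) ^ 3 + (z ^ 4) ^ 4 = 0"
    by (rule root5_conj[OF z]) simp
  have z5: "z ^ 5 = 1" using root5_power[OF z] .
  have pw: "(z ^ 4) ^ 2 = z ^ 3" "(z ^ 4) ^ 3 = z ^ 2" "(z ^ 4) ^ 4 = z"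
    using power_root5_mod[OF z5, of 8] power_root5_mod[OF z5, of 12] power_root5_mod[OF z5, of 16]
    by (simp_all flip: power_mult)
  define e S1 S2 where "e = z - z ^ 2 - z ^ 3 + z ^ 4" and "S1 = z - z ^ 4" and "S2 = z ^ 2 - z ^ 3"
  define X W V U :: complex where "X = of_int x" and "W = of_int w" and "V = of_int v" and "U = of_int u"
  note e2 = root5_quadratic(1)[OF z, folded e_def]
    and S11 = root5_quadratic(2)[OF z, folded e_def S1_def]
    and S22 = root5_quadratic(3)[OF z, folded e_def S2_def]
    and S12 = root5_quadratic(4)[OF z, folded e_def S1_def S2_def]
  have R: "X * W = V^2 - 4 * U * V - U^2"
    unfolding X_def W_def V_def U_def
    using arg_cong[OF rel, of "of_int :: int \<Rightarrow> complex"] by simp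
  have 1: "4 * eval_int_poly spoly z = (X + 5 * W * e) + ((4 * V + 2 * U) * S1 + (4 * U - 2 * V) * S2)"
    unfolding four_eval_spoly[OF z] e_def S1_def S2_def X_def W_def V_def U_def by (simp add: algebra_simps)
  have 2: "4 * eval_int_poly spoly (z ^ 4) = (X + 5 * W * e) - ((4 * V + 2 * U) * S1 + (4 * U - 2 * V) * S2)"
    unfolding four_eval_spoly[OF z'] pw e_def S1_def S2_def X_def W_def V_def U_def by (simp add: algebra_simps)
  have "16 * (eval_int_poly spoly z * eval_int_poly spoly (z ^ 4))
    = (4 * eval_int_poly spoly z) * (4 * eval_int_poly spoly (z ^ 4))" by simp
  also have "\<dots> = (X + 5 * W * e) ^ 2 - ((4 * V + 2 * U) * S1 + (4 * U - 2 * V) * S2) ^ 2"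
    unfolding 1 2 by (simp add: power2_eq_square algebra_simps)
  also have "\<dots> = X ^ 2 + 10 * (X * W) * e + 25 * W ^ 2 * (e * e)
    - (2 * (2 * V + U) ^ 2 * (2 * (S1 * S1)) + 2 * (2 * U - V) ^ 2 * (2 * (S2 * S2))
      + 8 * (2 * V + U) * (2 * U - V) * (S1 * S2))"
    by (simp add: power2_eq_square algebra_simps)
  also have "\<dots> = X ^ 2 + 125 * W ^ 2 + 50 * V ^ 2 + 50 * U ^ 2"
    unfolding e2 S11 S22 S12 R by (simp add: power2_eq_square algebra_simps)
  also have "\<dots> = 16 * of_int r"
    using arg_cong[OF norm, of "of_int :: int \<Rightarrow> complex"] unfolding X_def W_def V_def U_def by simp
  finally show ?thesis by simp
qed

lemma eval_spoly_1: "eval_int_poly spoly 1 = - x"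
proof -
  have "4 * (c1 + c2 + c3 + c4) = - 4 * x" unfolding distrib_left four_c by simp
  then show ?thesis by (simp add: spoly_def)
qed

lemma eval_spoly_transfer:
  assumes root: "N dvd eval_int_poly cyclo5 (t::int)"
  shows "[eval_int_poly spoly t * eval_int_poly spoly (t ^ 4) = r] (mod N)"
proof -
  have "eval_int_poly (spoly * pcompose spoly (Polynomial.monom 1 4)) zeta5 = eval_int_poly [:r:] zeta5"
    using eval_spoly_norm[OF zeta5_root] by simp
  from eval_int_poly_zeta5_transfer[OF this root] show ?thesis by simp
qed

text \<open>\<open>S\<close> and its conjugate \<open>S'\<close> satisfy
  \<open>(4 * (S + S') - 2 * x) ^ 2 = 500 * w ^ 2\<close>. If \<open>p\<close> divided both values,
  it would divide \<open>4 * (x ^ 2 - 125 * w ^ 2)\<close>.\<close>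

lemma eval_spoly_not_both:
  assumes p: "prime (p::nat)" "p \<noteq> 2" and root: "int p dvd eval_int_poly cyclo5 (t::int)"
    and ndvd: "\<not> int p dvd x ^ 2 - 125 * w ^ 2"
    and "int p dvd eval_int_poly spoly t" "int p dvd eval_int_poly spoly (t ^ 4)"
  shows False
proof -
  let ?S = "spoly + pcompose spoly (Polynomial.monom 1 4)"
  have z': "1 + zeta5 ^ 4 + (zeta5 ^ 4) ^ 2 + (zeta5 ^ 4) ^ 3 + (zeta5 ^ 4) ^ 4 = 0"
    by (rule root5_conj[OF zeta5_root]) simp
  have pw: "(zeta5 ^ 4) ^ 2 = zeta5 ^ 3" "(zeta5 ^ 4) ^ 3 = zeta5 ^ 2" "(zeta5 ^ 4) ^ 4 = zeta5"
    using power_root5_mod[OF zeta5_power_5, of 8] power_root5_mod[OF zeta5_power_5, of 12]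
      power_root5_mod[OF zeta5_power_5, of 16] by (simp_all flip: power_mult)
  define e where "e = zeta5 - zeta5 ^ 2 - zeta5 ^ 3 + zeta5 ^ 4"
  note e2 = root5_quadratic(1)[OF zeta5_root, folded e_def]
  have "4 * eval_int_poly ?S zeta5 = 4 * eval_int_poly spoly zeta5 + 4 * eval_int_poly spoly (zeta5 ^ 4)"
    by simp
  also have "\<dots> = 2 * of_int x + 10 * of_int w * e"
    unfolding four_eval_spoly[OF zeta5_root] four_eval_spoly[OF z'] pw e_def by (simp add: algebra_simps)
  finally have "(4 * eval_int_poly ?S zeta5 - 2 * of_int x) ^ 2 = (10 * of_int w) ^ 2 * (e * e)"
    by (simp add: power2_eq_square algebra_simps)
  then have "eval_int_poly ((Polynomial.smult 4 ?S - [:2 * x:]) ^ 2) zeta5 = eval_int_poly [:500 * w ^ 2:] zeta5"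
    unfolding e2 by (simp add: power_mult_distrib)
  from eval_int_poly_zeta5_transfer[OF this root]
  have "int p dvd (4 * (eval_int_poly spoly t + eval_int_poly spoly (t ^ 4)) - 2 * x) ^ 2 - 500 * w ^ 2"
    by (simp add: cong_iff_dvd_diff)
  moreover have "int p dvd 4 * (eval_int_poly spoly t + eval_int_poly spoly (t ^ 4))"
    using assms(5,6) by simp
  then obtain d where d: "4 * (eval_int_poly spoly t + eval_int_poly spoly (t ^ 4)) = int p * d" by blast
  ultimately have "int p dvd (int p * d - 2 * x) ^ 2 - 500 * w ^ 2" by simp
  also have "(int p * d - 2 * x) ^ 2 - 500 * w ^ 2
      = 2 * 2 * (x ^ 2 - 125 * w ^ 2) + int p * (int p * d ^ 2 - 4 * x * d)"
    by (simp add: power2_eq_square algebra_simps)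
  finally have "int p dvd 2 * 2 * (x ^ 2 - 125 * w ^ 2)" by (simp add: dvd_add_left_iff)
  moreover have "prime (int p)" using p by simp
  ultimately have "int p dvd 2" using ndvd by (simp only: prime_dvd_mult_iff) blast
  then have "p dvd 2" by (metis int_dvd_int_iff of_nat_numeral)
  moreover have "prime (2::nat)" by simp
  ultimately show False using p primes_dvd_imp_eq by blast
qed

text \<open>Coefficients of \<open>64 * S\<^sup>2 * \<sigma>\<^sub>2(S)\<close>, simplified by
  \<open>rel\<close>. The entries 2, 1, 3, 4 are \<open>5 * quintic_M\<close> at the iterates 0, 1,
  2, 3 of \<open>quintic_sigma\<close>.\<close>

definition h :: "nat \<Rightarrow> int" where
  "h k = [x ^ 3 - 20 * quintic_L (x, w, v, u), 5 * quintic_M (x, - w, - u, v),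
     5 * quintic_M (x, w, v, u), 5 * quintic_M (x, w, - v, - u), 5 * quintic_M (x, - w, u, - v)] ! k"

lemma eval_spoly_cube:
  assumes z: "1 + z + z ^ 2 + z ^ 3 + z ^ 4 = (0::complex)"
  shows "64 * (eval_int_poly spoly z ^ 2 * eval_int_poly spoly (z ^ 2)) = (\<Sum>i<5. of_int (h i) * z ^ i)"
proof -
  have z2: "1 + z ^ 2 + (z ^ 2) ^ 2 + (z ^ 2) ^ 3 + (z ^ 2) ^ 4 = 0"
    by (rule root5_conj[OF z]) simp
  have z5: "z ^ 5 = 1" using root5_power[OF z] .
  have pw: "(z ^ 2) ^ 2 = z ^ 4" "(z ^ 2) ^ 3 = z" "(z ^ 2) ^ 4 = z ^ 3"
    using power_root5_mod[OF z5, of 6] power_root5_mod[OF z5, of 8]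
    by (simp_all flip: power_mult)
  define a0 a1 a2 a3 a4 where "a0 = x" and "a1 = 5 * w + 4 * v + 2 * u" and "a2 = - 5 * w - 2 * v + 4 * u"
    and "a3 = - 5 * w + 2 * v - 4 * u" and "a4 = 5 * w - 4 * v - 2 * u"
  note a_defs = a0_def a1_def a2_def a3_def a4_def
  \<comment> \<open>\<open>h0\<close> to \<open>h4\<close> are the expanded coefficients of the
    squared element times its image under \<open>z \<mapsto> z ^ 2\<close>, with exponents reduced
    modulo 5.\<close>
  define h0 where "h0 = a0 * a0 * a0 + 2 * a0 * a1 * a2 + 2 * a0 * a1 * a3 + 2 * a0 * a1 * a4 + 2 * a0 * a2 * a3 + 2 * a0 * a2 * a4 + 2 * a0 * a3 * a4 + 2 * a1 * a1 * a2 + a1 * a1 * a4 + 2 * a1 * a3 * a3 + a1 * a4 * a4 + a2 * a2 * a3 + 2 * a2 * a2 * a4 + a2 * a3 * a3 + 2 * a3 * a4 * a4"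
  define h1 where "h1 = 2 * a0 * a0 * a1 + a0 * a0 * a3 + 2 * a0 * a1 * a4 + 2 * a0 * a2 * a2 + 2 * a0 * a2 * a4 + a0 * a3 * a3 + 2 * a0 * a3 * a4 + a1 * a1 * a2 + 2 * a1 * a1 * a3 + a1 * a2 * a2 + 2 * a1 * a2 * a4 + 2 * a1 * a3 * a4 + 2 * a2 * a3 * a3 + 2 * a2 * a3 * a4 + a4 * a4 * a4"
  define h2 where "h2 = a0 * a0 * a1 + 2 * a0 * a0 * a2 + a0 * a1 * a1 + 2 * a0 * a1 * a3 + 2 * a0 * a2 * a3 + 2 * a0 * a3 * a4 + 2 * a0 * a4 * a4 + 2 * a1 * a1 * a4 + 2 * a1 * a2 * a2 + 2 * a1 * a2 * a3 + 2 * a1 * a3 * a4 + a2 * a2 * a4 + 2 * a2 * a3 * a4 + a2 * a4 * a4 + a3 * a3 * a3"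
  define h3 where "h3 = 2 * a0 * a0 * a3 + a0 * a0 * a4 + 2 * a0 * a1 * a1 + 2 * a0 * a1 * a2 + 2 * a0 * a2 * a3 + 2 * a0 * a2 * a4 + a0 * a4 * a4 + a1 * a1 * a3 + 2 * a1 * a2 * a3 + 2 * a1 * a2 * a4 + a1 * a3 * a3 + 2 * a1 * a4 * a4 + a2 * a2 * a2 + 2 * a2 * a3 * a4 + 2 * a3 * a3 * a4"
  define h4 where "h4 = a0 * a0 * a2 + 2 * a0 * a0 * a4 + 2 * a0 * a1 * a2 + 2 * a0 * a1 * a3 + 2 * a0 * a1 * a4 + a0 * a2 * a2 + 2 * a0 * a3 * a3 + a1 * a1 * a1 + 2 * a1 * a2 * a3 + 2 * a1 * a2 * a4 + 2 * a1 * a3 * a4 + 2 * a2 * a2 * a3 + 2 * a2 * a4 * a4 + a3 * a3 * a4 + a3 * a4 * a4"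
  have "64 * (eval_int_poly spoly z ^ 2 * eval_int_poly spoly (z ^ 2))
      = (4 * eval_int_poly spoly z) ^ 2 * (4 * eval_int_poly spoly (z ^ 2))"
    by (simp add: power_mult_distrib)
  also have "\<dots> = (of_int a0 + of_int a1 * z + of_int a2 * z ^ 2 + of_int a3 * z ^ 3 + of_int a4 * z ^ 4) ^ 2
     * (of_int a0 + of_int a3 * z + of_int a1 * z ^ 2 + of_int a4 * z ^ 3 + of_int a2 * z ^ 4)"
    unfolding four_eval_spoly[OF z] four_eval_spoly[OF z2] pw a_defs by (simp add: algebra_simps)
  also have "\<dots> = of_int h0 + of_int h1 * z + of_int h2 * z ^ 2 + of_int h3 * z ^ 3 + of_int h4 * z ^ 4"
    unfolding power2_eq_square[of "of_int a0 + of_int a1 * z + of_int a2 * z ^ 2 + of_int a3 * z ^ 3 + of_int a4 * z ^ 4"]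
      root5_mult[OF z5] h0_def h1_def h2_def h3_def h4_def
    by (simp add: algebra_simps)
  also have "\<dots> = (\<Sum>i<5. of_int (h i) * z ^ i)"
  proof -
    have "h0 = h 0" "h1 = h 1" "h2 = h 2" "h3 = h 3" "h4 = h 4"
    proof -
      \<comment> \<open>The expansion agrees with \<open>h\<close> only modulo \<open>rel\<close>;
        the factors in front of \<open>R\<close> below are the cofactors that turn each comparison
        into a polynomial identity.\<close>
      define R where "R = x * w - (v^2 - 4 * u * v - u^2)"
      have R: "R = 0" using rel by (simp add: R_def)
      have "h0 = h 0 + (- 100 * w) * R"
        unfolding h0_def h_def a_defs R_def quintic_L_def quintic_M_def
        by (simp add: power2_eq_square power3_eq_cube algebra_simps)
      then show "h0 = h 0" using R by simp
      have "h1 = h 1 + (100 * v + 5 * x + 25 * w) * R"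
        unfolding h1_def h_def a_defs R_def quintic_L_def quintic_M_def
        by (simp add: power2_eq_square power3_eq_cube algebra_simps)
      then show "h1 = h 1" using R by simp
      have "h2 = h 2 + (- 100 * u + 25 * w - 5 * x) * R"
        unfolding h2_def h_def a_defs R_def quintic_L_def quintic_M_def
        by (simp add: power2_eq_square power3_eq_cube algebra_simps)
      then show "h2 = h 2" using R by simp
      have "h3 = h 3 + (100 * u - 5 * x + 25 * w) * R"
        unfolding h3_def h_def a_defs R_def quintic_L_def quintic_M_def
        by (simp add: power2_eq_square power3_eq_cube algebra_simps)
      then show "h3 = h 3" using R by simp
      have "h4 = h 4 + (- 100 * v + 25 * w + 5 * x) * R"
        unfolding h4_def h_def a_defs R_def quintic_L_def quintic_M_def
        by (simp add: power2_eq_square power3_eq_cube algebra_simps)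
      then show "h4 = h 4" using R by simp
    qed
    then show ?thesis by (simp add: eval_nat_numeral)
  qed
  finally show ?thesis .
qed

text \<open>Equivalently, the four \<open>quintic_sigma\<close> conjugates of
  \<open>quintic_M\<close> add up to \<open>4 * quintic_L\<close>.\<close>

lemma sum_h: "(\<Sum>i<5. h i) = x ^ 3"
  by (simp add: h_def quintic_L_def quintic_M_def eval_nat_numeral algebra_simps)

end

section \<open>Conjugation and units of absolute value one\<close>

lemma eval_int_poly_zeta5_conj:
  assumes "eval_int_poly P zeta5 = eval_int_poly Q zeta5" "\<not> 5 dvd j"
  shows "eval_int_poly P (zeta5 ^ j) = eval_int_poly Q (zeta5 ^ j)"
proof -
  have "cyclo5 dvd P - Q" using assms(1) by (intro cyclo5_dvd) simp
  then obtain R where "P - Q = cyclo5 * R" by blast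
  then have "eval_int_poly (P - Q) (zeta5 ^ j) = eval_int_poly cyclo5 (zeta5 ^ j) * eval_int_poly R (zeta5 ^ j)"
    by (simp only: eval_int_poly_mult)
  then show ?thesis using root5_conj[OF zeta5_root assms(2)] by (simp add: eval_cyclo5)
qed

text \<open>Adding \<open>a\<^sup>2 \<le> 2 * (y\<^sup>2 + (a - y)\<^sup>2)\<close> for
  \<open>y\<close> equal to \<open>b\<close>, \<open>c\<close> and \<open>d\<close> and inserting
  the hypothesis yields \<open>5 * a\<^sup>2 \<le> 8\<close>.\<close>

lemma norm_form_bound:
  fixes a b c d :: int
  assumes "a\<^sup>2 + b\<^sup>2 + c\<^sup>2 + d\<^sup>2 + (a - b)\<^sup>2 + (a - c)\<^sup>2 + (a - d)\<^sup>2 + (b - c)\<^sup>2 + (b - d)\<^sup>2 + (c - d)\<^sup>2 = 4"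
  shows "a \<in> {-1, 0, 1}"
proof -
  have sq: "a\<^sup>2 \<le> 2 * (y\<^sup>2 + (a - y)\<^sup>2)" for y
  proof -
    have "2 * (y\<^sup>2 + (a - y)\<^sup>2) - a\<^sup>2 = (2 * y - a)\<^sup>2"
      by (simp add: power2_eq_square algebra_simps)
    then show ?thesis using zero_le_power2[of "2 * y - a"] by linarith
  qed
  have nonneg: "0 \<le> (b - c)\<^sup>2" "0 \<le> (b - d)\<^sup>2" "0 \<le> (c - d)\<^sup>2" by simp_all
  have "5 * A \<le> 8" if "A + B + C + D + E + F + G + H + I + J = 4" "A \<le> 2 * (B + E)"
    "A \<le> 2 * (C + F)" "A \<le> 2 * (D + G)" "0 \<le> H" "0 \<le> I" "0 \<le> J"
    for A B C D E F G H I J :: int using that by (simp add: algebra_simps)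
  from this[OF assms sq[of b] sq[of c] sq[of d] nonneg] have "5 * a\<^sup>2 \<le> 8" .
  then have "a\<^sup>2 \<le> 1\<^sup>2" by simp
  then have "\<bar>a\<bar> \<le> 1" using abs_le_square_iff[of a 1] by simp
  then show ?thesis by auto
qed

text \<open>An explicit case of Kronecker's theorem. Independence of the powers splits the norm
  equation into two integer equations; together they say that the quadratic form of
  \<open>norm_form_bound\<close> takes the value 4, which leaves finitely many coefficient
  vectors.\<close>

lemma cyclo5_unit:
  assumes "eval_int_poly U zeta5 * eval_int_poly U (zeta5 ^ 4) = 1"
  shows "\<exists>l<5. \<exists>\<sigma>\<in>{-1, 1::int}. eval_int_poly U zeta5 = of_int \<sigma> * zeta5 ^ l"
proof -
  obtain b0 b1 b2 b3 Q where U: "U = [:b0, b1, b2, b3:] + cyclo5 * Q"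
    using cyclo5_reduce by blast
  have ev: "eval_int_poly U z = of_int b0 + of_int b1 * z + of_int b2 * z ^ 2 + of_int b3 * z ^ 3"
    if "1 + z + z ^ 2 + z ^ 3 + z ^ 4 = 0" for z :: complex
    using that unfolding U by (simp add: eval_cyclo5 algebra_simps eval_nat_numeral)
  have z': "1 + zeta5 ^ 4 + (zeta5 ^ 4) ^ 2 + (zeta5 ^ 4) ^ 3 + (zeta5 ^ 4) ^ 4 = 0"
    by (rule root5_conj[OF zeta5_root]) simp
  have pw: "(zeta5 ^ 4) ^ 2 = zeta5 ^ 3" "(zeta5 ^ 4) ^ 3 = zeta5 ^ 2"
    using power_root5_mod[OF zeta5_power_5, of 8] power_root5_mod[OF zeta5_power_5, of 12]
    by (simp_all flip: power_mult)
  define S where "S = b0\<^sup>2 + b1\<^sup>2 + b2\<^sup>2 + b3\<^sup>2"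
  define c1 where "c1 = b0 * b1 + b1 * b2 + b2 * b3"
  define c2 where "c2 = b0 * b2 + b1 * b3 + b0 * b3"
  have "(of_int b0 + of_int b1 * zeta5 + of_int b2 * zeta5 ^ 2 + of_int b3 * zeta5 ^ 3 + 0 * zeta5 ^ 4) *
      (of_int b0 + 0 * zeta5 + of_int b3 * zeta5 ^ 2 + of_int b2 * zeta5 ^ 3 + of_int b1 * zeta5 ^ 4) = 1"
    using assms unfolding ev[OF zeta5_root] ev[OF z'] pw by (simp add: algebra_simps)
  then have "of_int (S - 1) + of_int c1 * zeta5 + of_int c2 * zeta5 ^ 2 + of_int c2 * zeta5 ^ 3 + of_int c1 * zeta5 ^ 4 = 0"
    unfolding root5_mult[OF zeta5_power_5] by (simp add: S_def c1_def c2_def power2_eq_square algebra_simps)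
  then have "eval_int_poly [:S - 1 - c1, 0, c2 - c1, c2 - c1:] zeta5 + of_int c1 * (1 + zeta5 + zeta5 ^ 2 + zeta5 ^ 3 + zeta5 ^ 4) = 0"
    by (simp add: algebra_simps eval_nat_numeral)
  then have "eval_int_poly [:S - 1 - c1, 0, c2 - c1, c2 - c1:] zeta5 = 0" unfolding zeta5_root by simp
  from zeta5_indep[OF this] have c: "S = 1 + c1" "c2 = c1" by auto
  have N: "b0\<^sup>2 + b1\<^sup>2 + b2\<^sup>2 + b3\<^sup>2 + (b0 - b1)\<^sup>2 + (b0 - b2)\<^sup>2 + (b0 - b3)\<^sup>2 + (b1 - b2)\<^sup>2 + (b1 - b3)\<^sup>2 + (b2 - b3)\<^sup>2 = 4"
  proof -
    have "b0\<^sup>2 + b1\<^sup>2 + b2\<^sup>2 + b3\<^sup>2 + (b0 - b1)\<^sup>2 + (b0 - b2)\<^sup>2 + (b0 - b3)\<^sup>2 + (b1 - b2)\<^sup>2 + (b1 - b3)\<^sup>2 + (b2 - b3)\<^sup>2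
        = 4 * S - 2 * c1 - 2 * c2"
      unfolding S_def c1_def c2_def by (simp add: power2_eq_square algebra_simps)
    with c show ?thesis by simp
  qed
  have b0: "b0 \<in> {-1, 0, 1}" using N by (rule norm_form_bound)
  have b1: "b1 \<in> {-1, 0, 1}"
    by (rule norm_form_bound[of b1 b0 b2 b3]) (use N in \<open>simp add: power2_eq_square algebra_simps\<close>)
  have b2: "b2 \<in> {-1, 0, 1}"
    by (rule norm_form_bound[of b2 b0 b1 b3]) (use N in \<open>simp add: power2_eq_square algebra_simps\<close>)
  have b3: "b3 \<in> {-1, 0, 1}"
    by (rule norm_form_bound[of b3 b0 b1 b2]) (use N in \<open>simp add: power2_eq_square algebra_simps\<close>)
  \<comment> \<open>The vectors with all entries 1 or all entries -1 represent
    \<open>- zeta5 ^ 4\<close> and \<open>zeta5 ^ 4\<close>.\<close>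
  have "(b0, b1, b2, b3) \<in> {(1,0,0,0), (0,1,0,0), (0,0,1,0), (0,0,0,1), (1,1,1,1),
      (-1,0,0,0), (0,-1,0,0), (0,0,-1,0), (0,0,0,-1), (-1,-1,-1,-1)}"
    using b0 b1 b2 b3 N by (elim insertE emptyE) simp_all
  moreover have "zeta5 ^ 4 = - 1 - zeta5 - zeta5 ^ 2 - zeta5 ^ 3"
    using zeta5_root by (simp add: eq_neg_iff_add_eq_0 algebra_simps)
  ultimately have "eval_int_poly U zeta5 \<in> {1 * zeta5 ^ 0, 1 * zeta5 ^ 1, 1 * zeta5 ^ 2, 1 * zeta5 ^ 3, - 1 * zeta5 ^ 4,
      - 1 * zeta5 ^ 0, - 1 * zeta5 ^ 1, - 1 * zeta5 ^ 2, - 1 * zeta5 ^ 3, 1 * zeta5 ^ 4}"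
    unfolding ev[OF zeta5_root] by (elim insertE emptyE) simp_all
  then have "\<exists>l\<in>{0,1,2,3,4}. \<exists>\<sigma>\<in>{-1, 1::int}. eval_int_poly U zeta5 = of_int \<sigma> * zeta5 ^ l"
    by (elim insertE emptyE) simp_all
  then obtain l \<sigma> where "l \<in> {0,1,2,3,4::nat}" "\<sigma> \<in> {-1, 1::int}" "eval_int_poly U zeta5 = of_int \<sigma> * zeta5 ^ l"
    by blast
  moreover from this have "l < 5" by auto
  ultimately show ?thesis by blast
qed

lemma bij_betw_affine_mod_5:
  fixes k l :: nat
  assumes "\<not> 5 dvd k"
  shows "bij_betw (\<lambda>i. (k * (i + l)) mod 5) {..<5} {..<5}"
proof -
  have "inj_on (\<lambda>i. (k * (i + l)) mod 5) {..<5}"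
  proof (rule inj_onI)
    fix i j assume ij: "i \<in> {..<5}" "j \<in> {..<5}" and "(k * (i + l)) mod 5 = (k * (j + l)) mod 5"
    then have "[k * (i + l) = k * (j + l)] (mod 5)" by (simp only: cong_def)
    moreover have "coprime k 5"
      using assms prime_imp_coprime[of 5 k] by (simp add: coprime_commute)
    ultimately have "[i + l = j + l] (mod 5)" by (simp only: cong_mult_lcancel_nat)
    then have "[i = j] (mod 5)" by (simp only: cong_add_rcancel_nat)
    with ij show "i = j" by (simp add: cong_less_modulus_unique_nat)
  qed
  moreover have "(\<lambda>i. (k * (i + l)) mod 5) ` {..<5} \<subseteq> {..<5}" by auto
  ultimately show ?thesis by (simp add: bij_betw_def endo_inj_surj)
qed

section \<open>Comparison of the Gauss sum with a solution\<close>

context quintic_field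
begin

text \<open>The quotient of the Gauss sum by a suitable conjugate of \<open>\<gamma>\<close> is
  \<open>- zeta5 ^ l\<close>. The choice of the conjugate and the exponent \<open>l\<close> only
  permute the periods; \<open>f\<close> is this permutation.\<close>

lemma eta_eq_solution:
  assumes "quintic_solution (int p ^ s) x w v u"
    and m: "m = 5 * s" and x5: "[x = - 1] (mod 5)" and ndvd: "\<not> int p dvd x ^ 2 - 125 * w ^ 2"
  shows "\<exists>f. bij_betw f {..<5} {..<5} \<and> (\<forall>i<5. 5 * of_int (eta i) + 1
    = - (of_nat p ^ s / 64) * (5 * of_int (quintic_solution.h x w v u (f i)) - of_int x ^ 3 :: complex))"
proof -
  interpret S: quintic_solution "int p ^ s" x w v u by fact
  define r where "r = int p ^ s"
  have pne: "p \<noteq> 5" "p \<noteq> 2" using p_mod_5 by (auto simp: cong_def)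
  have q_r: "int p ^ m = r ^ 5" unfolding r_def m by (simp add: mult.commute flip: power_mult)
  obtain c where c: "\<tau> = of_nat c"
  proof -
    have "\<tau> ^ p = \<tau> ^ 1" unfolding tau_power_eq_iff by (rule p_mod_5)
    then show thesis using prime_subfield[OF card prime_p, of \<tau>] that by auto
  qed
  have "of_int (eval_int_poly cyclo5 (int c)) = (0::'a)"
    using tau_root unfolding of_int_eval_int_poly eval_cyclo5 by (simp add: c)
  then have "int p dvd eval_int_poly cyclo5 (int c)" by (simp add: of_int_eq_0_iff_char_dvd char)
  from cyclo5_root_lift[OF prime_p pne(1) this, of "4 * m"] obtain t
    where t: "[t = int c] (mod int p)" and root: "int p ^ (4 * m) dvd eval_int_poly cyclo5 t"
    by blast
  have "of_int t = (of_int (int c) :: 'a)" using t by (simp only: of_int_eq_iff_cong_CHAR char)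
  then have t_tau: "of_int t = \<tau>" using c by simp
  have r_dvd: "r dvd int p ^ (4 * m)" unfolding r_def m by (rule le_imp_power_dvd) simp
  have q_dvd: "int p ^ m dvd int p ^ (4 * m)" by (rule le_imp_power_dvd) simp
  have p_dvd: "int p dvd int p ^ (4 * m)" using m_pos by (simp add: dvd_power)
  have periodic: "[eval_int_poly P (t ^ i) = eval_int_poly P (t ^ j)] (mod int p ^ (4 * m))"
    if "[i = j] (mod 5)" for P i j
  proof -
    have "eval_int_poly (pcompose P (Polynomial.monom 1 i)) zeta5 = eval_int_poly (pcompose P (Polynomial.monom 1 j)) zeta5"
      using zeta5_power_cong[OF that] by simp
    from eval_int_poly_zeta5_transfer[OF this root] show ?thesis by simp
  qed
  define F where "F = (\<lambda>j. r dvd eval_int_poly S.spoly (t ^ j))"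
  have F_cong: "F i \<longleftrightarrow> F j" if "[i = j] (mod 5)" for i j
    unfolding F_def using cong_dvd_iff[OF cong_dvd_modulus[OF periodic[OF that] r_dvd]] .
  \<comment> \<open>The product of the two values is divisible by \<open>r\<close>, and
    \<open>p\<close> does not divide both, so one is coprime to \<open>r\<close> and the other
    absorbs all of \<open>r\<close>.\<close>
  have F_or: "F j \<or> F (4 * j)" if j: "\<not> 5 dvd j" for j
  proof -
    let ?a = "eval_int_poly S.spoly (t ^ j)" and ?b = "eval_int_poly S.spoly (t ^ (4 * j))"
    have root_j: "int p ^ (4 * m) dvd eval_int_poly cyclo5 (t ^ j)"
      using root j by (rule cyclo5_dvd_conj)
    have b: "?b = eval_int_poly S.spoly ((t ^ j) ^ 4)" by (simp add: mult.commute flip: power_mult)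
    have "[?a * ?b = r] (mod r)"
      using cong_dvd_modulus[OF S.eval_spoly_transfer[OF root_j] r_dvd] unfolding b r_def .
    then have ab: "r dvd ?a * ?b" by (simp add: cong_dvd_iff)
    have "\<not> int p dvd ?a \<or> \<not> int p dvd ?b"
      using S.eval_spoly_not_both[OF prime_p pne(2) dvd_trans[OF p_dvd root_j] ndvd] unfolding b by blast
    then have "coprime r ?a \<or> coprime r ?b"
      using prime_p unfolding r_def by (auto intro!: coprime_power_left_iff[THEN iffD2] prime_imp_coprime)
    then show ?thesis
      using ab unfolding F_def by (auto simp: coprime_dvd_mult_left_iff coprime_dvd_mult_right_iff)
  qed
  \<comment> \<open>Some conjugate of the solution is divisible by \<open>r\<close> at the same conjugates of \<open>t\<close>
    as the Jacobi sum \<open>J(\<chi>,\<chi>)\<close>.\<close>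
  have "\<exists>k\<in>{1,2,3,4}. F k \<and> F (2 * k)"
  proof -
    have eqs: "F 8 = F 3" "F 6 = F 1" by (rule F_cong; simp add: cong_def)+
    have "F 1 \<or> F 4" "F 2 \<or> F 8" using F_or[of 1] F_or[of 2] by simp_all
    then show ?thesis unfolding eqs using eqs by auto
  qed
  then obtain k where k: "k \<in> {1,2,3,4::nat}" and Fk: "F k" "F (2 * k)" by blast
  have k5: "\<not> 5 dvd k" using k by auto
  define \<gamma> where "\<gamma> = Polynomial.smult r (S.spoly ^ 2 * pcompose S.spoly (Polynomial.monom 1 2))"
  have eval_\<gamma>: "eval_int_poly \<gamma> z = of_int r * (eval_int_poly S.spoly z ^ 2 * eval_int_poly S.spoly (z ^ 2))"
    for z :: "'z::comm_ring_1" by (simp add: \<gamma>_def)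
  \<comment> \<open>Division by the \<open>k\<close>-th conjugate of \<open>\<gamma>\<close> is
    replaced by multiplication with its complex conjugate, the one of exponent \<open>4 * k\<close>,
    followed by division by \<open>q\<close>.\<close>
  define H where "H = gpoly * pcompose \<gamma> (Polynomial.monom 1 (4 * k))"
  \<comment> \<open>The Gauss sum contributes \<open>r ^ (5 - j)\<close> and the conjugate of
    \<open>\<gamma>\<close> contributes \<open>r ^ j\<close>, together
    \<open>r ^ 5 = q\<close>.\<close>
  have H_dvd: "int p ^ m dvd eval_int_poly H (t ^ j)" if j: "j \<in> {1..4}" for j
  proof -
    define A where "A = eval_int_poly S.spoly (t ^ (k * (4 * j)))"
    define B where "B = eval_int_poly S.spoly (t ^ (k * (8 * j)))"
    have eH: "eval_int_poly H (t ^ j) = eval_int_poly gpoly (t ^ j) * (r * A ^ 2 * B)"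
      unfolding H_def A_def B_def by (simp add: eval_\<gamma> mult_ac flip: power_mult)
    have G: "r ^ (5 - j) dvd eval_int_poly gpoly (t ^ j)"
      unfolding r_def by (rule gpoly_divisible[OF t_tau root m j])
    have A: "r dvd A" if "(4 * j) mod 5 \<in> {1, 2}"
    proof -
      have "F (k * (4 * j)) \<longleftrightarrow> F (k * ((4 * j) mod 5))"
        by (rule F_cong) (simp add: cong_def mod_mult_right_eq)
      with that Fk show ?thesis by (auto simp: A_def F_def mult.commute)
    qed
    have B: "r dvd B" if "(8 * j) mod 5 \<in> {1, 2}"
    proof -
      have "F (k * (8 * j)) \<longleftrightarrow> F (k * ((8 * j) mod 5))"
        by (rule F_cong) (simp add: cong_def mod_mult_right_eq)
      with that Fk show ?thesis by (auto simp: B_def F_def mult.commute)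
    qed
    have "r ^ j dvd r * A ^ 2 * B"
    proof -
      have "j = 1 \<or> j = 2 \<or> j = 3 \<or> j = 4" using j by auto
      then show ?thesis
      proof (elim disjE)
        assume j: "j = 2"
        have "r * 1 * r dvd r * A ^ 2 * B"
          by (intro mult_dvd_mono B dvd_refl one_dvd) (simp add: j)
        then show ?thesis by (simp add: j eval_nat_numeral)
      next
        assume j: "j = 3"
        have "r * r ^ 2 * 1 dvd r * A ^ 2 * B"
          by (intro mult_dvd_mono A dvd_power_same dvd_refl one_dvd) (simp add: j)
        then show ?thesis by (simp add: j eval_nat_numeral)
      next
        assume j: "j = 4"
        have "r * r ^ 2 * r dvd r * A ^ 2 * B"
          by (intro mult_dvd_mono A B dvd_power_same dvd_refl) (simp_all add: j)
        then show ?thesis by (simp add: j eval_nat_numeral)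
      qed simp
    qed
    with G have "r ^ (5 - j) * r ^ j dvd eval_int_poly H (t ^ j)" unfolding eH by (intro mult_dvd_mono)
    moreover have "r ^ (5 - j) * r ^ j = int p ^ m" using j by (simp add: q_r flip: power_add)
    ultimately show ?thesis by simp
  qed
  have "coprime 5 (int p)" using pne(1) prime_p by (intro primes_coprime) auto
  then have "coprime 5 (int p ^ m)" by simp
  from cyclo5_divisible[OF this dvd_trans[OF q_dvd root] H_dvd] obtain U Q
    where HU: "H = Polynomial.smult (int p ^ m) U + cyclo5 * Q" by blast
  have q0: "(of_nat q :: complex) \<noteq> 0" using p_gt_1 by simp
  have \<gamma>_norm: "eval_int_poly \<gamma> (zeta5 ^ i) * eval_int_poly \<gamma> (zeta5 ^ (4 * i)) = of_nat q" if i: "\<not> 5 dvd i" for i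
  proof -
    have n: "eval_int_poly S.spoly (zeta5 ^ i) * eval_int_poly S.spoly (zeta5 ^ (4 * i)) = of_int r"
      if "\<not> 5 dvd i" for i
      using S.eval_spoly_norm[OF root5_conj[OF zeta5_root that]]
      unfolding r_def by (simp add: mult.commute flip: power_mult)
    have "\<not> 5 dvd 2 * i" using i by presburger
    note n2 = n[OF this]
    have sq: "(zeta5 ^ i) ^ 2 = zeta5 ^ (2 * i)" "(zeta5 ^ (4 * i)) ^ 2 = zeta5 ^ (4 * (2 * i))"
      by (simp_all only: power_mult[symmetric] mult_ac)
    have "eval_int_poly \<gamma> (zeta5 ^ i) * eval_int_poly \<gamma> (zeta5 ^ (4 * i))
      = of_int r ^ 2 * (eval_int_poly S.spoly (zeta5 ^ i) * eval_int_poly S.spoly (zeta5 ^ (4 * i))) ^ 2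
        * (eval_int_poly S.spoly (zeta5 ^ (2 * i)) * eval_int_poly S.spoly (zeta5 ^ (4 * (2 * i))))"
      unfolding eval_\<gamma> sq by (simp add: power_mult_distrib power2_eq_square mult_ac)
    also have "\<dots> = of_int (r ^ 5)" unfolding n[OF i] n2 by (simp add: eval_nat_numeral)
    also have "\<dots> = of_nat q" unfolding q_r[symmetric] by simp
    finally show ?thesis .
  qed
  have eqU: "eval_int_poly gpoly zeta5 = eval_int_poly (U * pcompose \<gamma> (Polynomial.monom 1 k)) zeta5"
  proof -
    have "eval_int_poly gpoly zeta5 * eval_int_poly \<gamma> (zeta5 ^ (4 * k)) = of_nat q * eval_int_poly U zeta5"
      using arg_cong[OF HU, of "\<lambda>P. eval_int_poly P zeta5"] zeta5_root
      by (simp add: H_def eval_cyclo5)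
    then have "eval_int_poly gpoly zeta5 * (eval_int_poly \<gamma> (zeta5 ^ k) * eval_int_poly \<gamma> (zeta5 ^ (4 * k)))
      = of_nat q * (eval_int_poly U zeta5 * eval_int_poly \<gamma> (zeta5 ^ k))"
      by (simp add: mult_ac)
    then have "eval_int_poly gpoly zeta5 * of_nat q = (eval_int_poly U zeta5 * eval_int_poly \<gamma> (zeta5 ^ k)) * of_nat q"
      unfolding \<gamma>_norm[OF k5] by (simp only: mult.commute)
    then have "eval_int_poly gpoly zeta5 = eval_int_poly U zeta5 * eval_int_poly \<gamma> (zeta5 ^ k)"
      using q0 by (simp only: mult_cancel_right) blast
    then show ?thesis by simp
  qed
  have "eval_int_poly U zeta5 * eval_int_poly U (zeta5 ^ 4) = 1"
  proof -
    have 4: "\<not> 5 dvd (4::nat)" by simp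
    have g4: "eval_int_poly gpoly (zeta5 ^ 4) = eval_int_poly U (zeta5 ^ 4) * eval_int_poly \<gamma> (zeta5 ^ (4 * k))"
      using eval_int_poly_zeta5_conj[OF eqU 4] by (simp flip: power_mult)
    have "eval_int_poly gpoly zeta5 * eval_int_poly gpoly (zeta5 ^ 4) = of_nat q"
      using eval_gpoly_norm[of 1] by simp
    then have "eval_int_poly U zeta5 * eval_int_poly U (zeta5 ^ 4)
        * (eval_int_poly \<gamma> (zeta5 ^ k) * eval_int_poly \<gamma> (zeta5 ^ (4 * k))) = 1 * of_nat q"
      unfolding g4 eqU by (simp add: mult_ac)
    then show ?thesis unfolding \<gamma>_norm[OF k5] using q0 by (simp only: mult_cancel_right) blast
  qed
  from cyclo5_unit[OF this] obtain l \<sigma> where l: "l < 5" and \<sigma>: "\<sigma> \<in> {-1, 1::int}"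
    and U: "eval_int_poly U zeta5 = of_int \<sigma> * zeta5 ^ l" by blast
  define R where "R = Polynomial.monom \<sigma> l * pcompose \<gamma> (Polynomial.monom 1 k)"
  have eqR: "eval_int_poly gpoly zeta5 = eval_int_poly R zeta5"
    using eqU by (simp add: R_def U)
  \<comment> \<open>Modulo 5 the number 1 is a root of \<open>cyclo5\<close>, so
    \<open>zeta5\<close> may be replaced by 1, where the Gauss sum becomes -1 and
    \<open>\<gamma>\<close> becomes 1.\<close>
  have "\<sigma> = - 1"
  proof -
    have "5 dvd eval_int_poly cyclo5 (1::int)" by (simp add: eval_cyclo5)
    from eval_int_poly_zeta5_transfer[OF eqR this]
    have "[- 1 = \<sigma> * (r * (- x) ^ 2 * (- x))] (mod 5)"
      by (simp add: eval_gpoly_1 R_def eval_\<gamma> S.eval_spoly_1 mult.assoc)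
    moreover have "[\<sigma> * (r * (- x) ^ 2 * (- x)) = \<sigma> * (1 ^ s * 1 ^ 2 * 1)] (mod 5)"
    proof -
      have "[int p = 1] (mod 5)" using p_mod_5 cong_int_iff[of p 1 5] by simp
      moreover have "[- x = 1] (mod 5)" using x5 cong_minus_minus_iff[of x "- 1" 5] by simp
      ultimately show ?thesis unfolding r_def by (intro cong_mult cong_pow cong_refl)
    qed
    ultimately have "[- 1 = \<sigma>] (mod 5)" using cong_trans by fastforce
    with \<sigma> show ?thesis by (auto simp: cong_def)
  qed
  have main: "5 * of_int (eta i) + 1 = - (of_nat p ^ s / 64) *
      (5 * of_int (S.h ((k ^ 3 * (i + (5 - l))) mod 5)) - of_int x ^ 3 :: complex)" if i: "i < 5" for i
  proof -
    \<comment> \<open>The index solves \<open>k * c = i - l\<close> modulo 5: \<open>k ^ 3\<close>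
      is the inverse of \<open>k\<close>, and \<open>5 - l\<close> represents \<open>- l\<close> as
      a natural number.\<close>
    define c where "c = (k ^ 3 * (i + (5 - l))) mod 5"
    have c5: "c < 5" by (simp add: c_def)
    have zk: "1 + zeta5 ^ k + (zeta5 ^ k) ^ 2 + (zeta5 ^ k) ^ 3 + (zeta5 ^ k) ^ 4 = 0"
      by (rule root5_conj[OF zeta5_root k5])
    have exp: "[j * (5 - i) + j * l = k * (j * (5 - c))] (mod 5)" for j
    proof -
      have "[(5 - i) + l = k * (5 - c)] (mod 5)"
      proof -
        have "int (5 - i + l) = 5 - int i + int l" "int (k * (5 - c)) = int k * (5 - int c)"
          using i c5 by (simp_all add: of_nat_diff)
        moreover have "[int k * (5 - int c) = int k * (5 - int k ^ 3 * (int i + (5 - int l)))] (mod 5)"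
          unfolding c_def using l
          by (intro cong_scalar_left cong_diff cong_refl) (simp add: cong_def of_nat_mod of_nat_diff add_diff_eq)
        moreover have "[int k * (5 - int k ^ 3 * (int i + (5 - int l))) = 5 - int i + int l] (mod 5)"
        proof -
          have d: "int k * (5 - int k ^ 3 * (int i + (5 - int l))) - (5 - int i + int l)
            = 5 * (int k - int k ^ 4 - 1) + (int k ^ 4 - 1) * (int l - int i)"
            by (simp add: algebra_simps eval_nat_numeral)
          have "5 dvd int k ^ 4 - 1" using k by auto
          then show ?thesis unfolding cong_iff_dvd_diff d by (intro dvd_add dvd_triv_left dvd_mult2)
        qed
        ultimately have "[int (5 - i + l) = int (k * (5 - c))] (mod int 5)"
          by (metis cong_sym cong_trans of_nat_numeral)
        then show ?thesis by (simp only: cong_int_iff)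
      qed
      from cong_scalar_left[OF this, of j] show ?thesis by (simp add: distrib_left mult_ac)
    qed
    have "5 * of_int (eta i) + 1 = (\<Sum>j=1..4. zeta5 ^ (j * (5 - i)) * eval_int_poly gpoly (zeta5 ^ j))"
      using eta_trace[OF i] by simp
    also have "\<dots> = (\<Sum>j=1..4. - (of_nat p ^ s / 64) * ((zeta5 ^ k) ^ (j * (5 - c)) * (\<Sum>a<5. of_int (S.h a) * (zeta5 ^ k) ^ (a * j))))"
    proof (rule sum.cong)
      fix j :: nat assume "j \<in> {1..4}"
      then have j: "\<not> 5 dvd j" by auto
      have "\<not> 5 dvd j * k" using j k5 prime_dvd_mult_iff[of "5::nat" j k] by simp
      note zjk = root5_conj[OF zeta5_root this]
      have "eval_int_poly gpoly (zeta5 ^ j) = - ((zeta5 ^ j) ^ l * (of_nat p ^ s *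
          (eval_int_poly S.spoly (zeta5 ^ (j * k)) ^ 2 * eval_int_poly S.spoly ((zeta5 ^ (j * k)) ^ 2))))"
        unfolding eval_int_poly_zeta5_conj[OF eqR j] R_def
        by (simp add: \<open>\<sigma> = - 1\<close> eval_\<gamma> r_def flip: power_mult)
      also have "\<dots> = - (of_nat p ^ s / 64) * ((zeta5 ^ j) ^ l *
          (64 * (eval_int_poly S.spoly (zeta5 ^ (j * k)) ^ 2 * eval_int_poly S.spoly ((zeta5 ^ (j * k)) ^ 2))))"
        by simp
      also have "\<dots> = - (of_nat p ^ s / 64) * (zeta5 ^ (j * l) * (\<Sum>a<5. of_int (S.h a) * (zeta5 ^ k) ^ (a * j)))"
        unfolding S.eval_spoly_cube[OF zjk] by (simp add: mult_ac flip: power_mult)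
      finally have "zeta5 ^ (j * (5 - i)) * eval_int_poly gpoly (zeta5 ^ j)
        = - (of_nat p ^ s / 64) * (zeta5 ^ (j * (5 - i) + j * l) * (\<Sum>a<5. of_int (S.h a) * (zeta5 ^ k) ^ (a * j)))"
        by (simp add: power_add mult_ac)
      also have "zeta5 ^ (j * (5 - i) + j * l) = (zeta5 ^ k) ^ (j * (5 - c))"
        unfolding power_mult[symmetric] using exp by (rule zeta5_power_cong)
      finally show "zeta5 ^ (j * (5 - i)) * eval_int_poly gpoly (zeta5 ^ j)
        = - (of_nat p ^ s / 64) * ((zeta5 ^ k) ^ (j * (5 - c)) * (\<Sum>a<5. of_int (S.h a) * (zeta5 ^ k) ^ (a * j)))" .
    qed simp
    also have "\<dots> = - (of_nat p ^ s / 64) * (5 * of_int (S.h c) - (\<Sum>a<5. of_int (S.h a)))"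
      unfolding sum_distrib_left[symmetric] root5_trace[OF zk c5] by (rule refl)
    also have "(\<Sum>a<5. of_int (S.h a)) = (of_int x ^ 3 :: complex)"
      using S.sum_h by (metis of_int_power of_int_sum)
    finally show ?thesis unfolding c_def .
  qed
  have "\<not> 5 dvd k ^ 3" using k by auto
  from bij_betw_affine_mod_5[OF this, of "5 - l"] main show ?thesis by blast
qed

end

section \<open>The spectrum\<close>

text \<open>The constant matrix \<open>K V\<close> intertwines the characteristic matrices of
  \<open>A\<close> and of the diagonal matrix, and its nonzero determinant cancels. With
  \<open>mat c\<close> instead of the identity, an unnormalised character table can serve as
  \<open>V\<close>.\<close>

lemma charpoly_eigenbasis:
  fixes A V W :: "complex ^ 'n ^ 'n" and d :: "'n \<Rightarrow> complex"
  assumes eig: "A ** V = V ** (\<chi> i j. if i = j then d j else 0)" and inv: "V ** W = mat c" and "c \<noteq> 0"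
  shows "charpoly A = (\<Prod>i\<in>UNIV. [:- d i, 1:])"
proof -
  define K :: "complex ^ 'n ^ 'n \<Rightarrow> complex poly ^ 'n ^ 'n" where "K = (\<lambda>M. \<chi> i j. [:M $ i $ j:])"
  have const_sum: "[:\<Sum>i\<in>S. f i:] = (\<Sum>i\<in>S. [:f i:])" for f :: "'n \<Rightarrow> complex" and S
  proof (induction S rule: infinite_finite_induct)
    case (insert x F)
    have "[:a + b:] = [:a:] + [:b:]" for a b :: complex by simp
    with insert show ?case by (simp only: sum.insert if_False simp_thms)
  qed simp_all
  have K_mult: "K M ** K N = K (M ** N)" for M N
    by (simp add: K_def matrix_matrix_mult_def vec_eq_iff const_sum mult.commute)
  define D :: "complex poly ^ 'n ^ 'n" where "D = (\<chi> i j. if i = j then [:- d i, 1:] else 0)"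
  have D: "D = mat [:0, 1:] - K (\<chi> i j. if i = j then d j else 0)"
    by (simp add: D_def K_def mat_def vec_eq_iff)
  have "(mat [:0, 1:] - K A) ** K V = K V ** D"
  proof -
    have comm: "mat x ** M = M ** mat x" for x and M :: "complex poly ^ 'n ^ 'n"
      by (simp add: matrix_matrix_mult_def mat_def vec_eq_iff if_distrib cong: if_cong)
        (simp add: if_distribR mult.commute cong: if_cong)
    have rd: "(M - N) ** L = M ** L - N ** L" and ld: "L ** (M - N) = L ** M - L ** N"
      for L M N :: "complex poly ^ 'n ^ 'n"
      by (simp_all add: matrix_matrix_mult_def vec_eq_iff algebra_simps sum_subtractf)
    show ?thesis
      unfolding D rd ld K_mult eig by (simp only: comm)
  qed
  then have "det ((mat [:0, 1:] - K A) ** K V) = det (K V ** D)" by (rule arg_cong)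
  then have "det (mat [:0, 1:] - K A) * det (K V) = det D * det (K V)"
    by (simp only: det_mul mult.commute)
  moreover have "det (K V) \<noteq> 0"
  proof -
    have "K (mat c) = mat [:c:]" by (simp add: K_def mat_def vec_eq_iff)
    then have "det (K V) * det (K W) = det (mat [:c:] :: complex poly ^ 'n ^ 'n)"
      by (simp only: det_mul[symmetric] K_mult inv)
    also have "\<dots> = [:c:] ^ CARD('n)" by (subst det_diagonal) (simp_all add: mat_def)
    also have "\<dots> \<noteq> 0" using assms(3) by simp
    finally show ?thesis by auto
  qed
  ultimately have "det (mat [:0, 1:] - K A) = det D" by simp
  also have "det D = (\<Prod>i\<in>UNIV. [:- d i, 1:])" by (subst det_diagonal) (simp_all add: D_def)
  finally show ?thesis by (simp add: charpoly_def K_def)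
qed

context quintic_field
begin

text \<open>The columns of \<open>V\<close> are the additive characters, which are eigenvectors for
  every connection set; their orthogonality inverts \<open>V\<close> up to the factor
  \<open>q\<close>.\<close>

lemma Spec_cayley_digraph:
  fixes S :: "'a set"
  shows "Spec (cayley_digraph S) = (\<Sum>b\<in>UNIV. {#\<Sum>y\<in>S. psi (b * y)#})"
proof -
  define d where "d = (\<lambda>b. \<Sum>y\<in>S. psi (b * y))"
  define V where "V = (\<chi> a b. psi (a * b))"
  define W where "W = (\<chi> b a. psi (- (b * a)))"
  have "adjacency_matrix (cayley_digraph S) ** V = V ** (\<chi> i j. if i = j then d j else 0)"
  proof -
    have "(\<Sum>k\<in>UNIV. (if k - a \<in> S then 1 else 0) * psi (k * b)) = psi (a * b) * d b" for a b
    proof -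
      have "(\<Sum>k\<in>UNIV. (if k - a \<in> S then 1 else 0) * psi (k * b))
        = (\<Sum>y\<in>UNIV. (if y \<in> S then psi ((a + y) * b) else 0))"
        by (rule sum.reindex_bij_witness[of _ "\<lambda>y. a + y" "\<lambda>k. k - a"]) auto
      also have "\<dots> = (\<Sum>y\<in>S. psi ((a + y) * b))" by (simp add: sum.If_cases)
      also have "\<dots> = psi (a * b) * d b"
        by (simp add: d_def distrib_right psi_add sum_distrib_left mult.commute[of b])
      finally show ?thesis .
    qed
    then show ?thesis
      by (simp add: adjacency_matrix_def cayley_digraph_def V_def matrix_matrix_mult_def vec_eq_iff
        if_distrib[of "\<lambda>x. _ * x"] cong: if_cong)
  qed
  moreover have "V ** W = mat (of_nat q)"
  proof -
    have "(\<Sum>k\<in>UNIV. psi (a * k) * psi (- (k * b))) = (if a = b then of_nat q else 0)" for a b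
    proof -
      have "psi (a * k) * psi (- (k * b)) = psi ((a - b) * k)" for k
        by (simp add: algebra_simps flip: psi_add)
      then show ?thesis by (simp add: sum_psi_mult)
    qed
    then show ?thesis by (simp add: V_def W_def matrix_matrix_mult_def mat_def vec_eq_iff)
  qed
  moreover have "of_nat q \<noteq> (0::complex)" using p_gt_1 by simp
  ultimately have "charpoly (adjacency_matrix (cayley_digraph S)) = (\<Prod>b\<in>UNIV. [:- d b, 1:])"
    by (rule charpoly_eigenbasis)
  then have "Spec (cayley_digraph S) = (\<Sum>b\<in>UNIV. proots [:- d b, 1:])"
    unfolding Spec_def by (simp add: proots_prod)
  then show ?thesis by (simp add: d_def)
qed

text \<open>Multiplication by a nonzero \<open>b\<close> carries \<open>fibre 0\<close> onto the
  fibre of \<open>b\<close>, so its eigenvalue is the period of that fibre; \<open>b = 0\<close>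
  gives the valency.\<close>

lemma Spec_gen_paley:
  "Spec (gen_paley 5 :: 'a pair_pre_digraph) = {#of_nat n#} + (\<Sum>i<5. replicate_mset n (of_int (eta i)))"
proof -
  have eig: "(\<Sum>y\<in>fibre 0. psi (b * y)) = of_int (eta i)" if b: "b \<in> fibre i" for b i
  proof -
    have b0: "b \<noteq> 0" and bi: "idx b = i" using b by (auto simp: fibre_def)
    have fwd: "b * y \<in> fibre i" if "y \<in> fibre 0" for y
    proof -
      have "[idx (b * y) = idx b] (mod 5)" using idx_mult[of b y] that b0 by (simp add: fibre_def)
      then show ?thesis using idx(1)[of b] idx(1)[of "b * y"] that b0 bi
        by (simp add: fibre_def cong_less_modulus_unique_nat)
    qed
    have bwd: "y / b \<in> fibre 0" if "y \<in> fibre i" for y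
    proof -
      have y: "y \<noteq> 0" "idx y = idx b" using that bi by (auto simp: fibre_def)
      have "[idx (b * (y / b)) = idx b + idx (y / b)] (mod 5)" using y b0 by (intro idx_mult) auto
      then have "[idx b + 0 = idx b + idx (y / b)] (mod 5)" using y b0 by simp
      then have "[0 = idx (y / b)] (mod 5)" by (simp only: cong_add_lcancel_nat)
      moreover have "idx (y / b) < 5" using y b0 by (intro idx(1)) simp
      ultimately have "idx (y / b) = 0" by (simp add: cong_def)
      then show ?thesis using y b0 by (simp add: fibre_def)
    qed
    have "(\<Sum>y\<in>fibre 0. psi (b * y)) = (\<Sum>y\<in>fibre i. psi y)"
      by (rule sum.reindex_bij_witness[of _ "\<lambda>y. y / b" "\<lambda>y. b * y"]) (use b0 fwd bwd in auto)
    then show ?thesis by (simp add: eta)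
  qed
  have "Spec (gen_paley 5 :: 'a pair_pre_digraph) = (\<Sum>b\<in>UNIV. {#\<Sum>y\<in>fibre 0. psi (b * y)#})"
    unfolding gen_paley_def fifth_powers by (rule Spec_cayley_digraph)
  also have "\<dots> = {#\<Sum>y\<in>fibre 0. psi (0 * y)#} + (\<Sum>b\<in>UNIV - {0}. {#\<Sum>y\<in>fibre 0. psi (b * y)#})"
    by (rule sum.remove) auto
  also have "(\<Sum>b\<in>UNIV - {0}. {#\<Sum>y\<in>fibre 0. psi (b * y)#}) = (\<Sum>i<5. \<Sum>b\<in>fibre i. {#\<Sum>y\<in>fibre 0. psi (b * y)#})"
    by (rule sum_fibre)
  also have "\<dots> = (\<Sum>i<5. replicate_mset n (of_int (eta i)))"
  proof (rule sum.cong)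
    fix i :: nat assume "i \<in> {..<5}"
    then have i: "card (fibre i) = n" by (simp add: card_fibre)
    have const: "(\<Sum>b\<in>B. {#a#}) = replicate_mset (card B) a" if "finite B" for B :: "'a set" and a :: complex
      using that by induction simp_all
    have "(\<Sum>b\<in>fibre i. {#\<Sum>y\<in>fibre 0. psi (b * y)#}) = (\<Sum>b\<in>fibre i. {#of_int (eta i)#})"
      by (rule sum.cong) (simp_all add: eig)
    then show "(\<Sum>b\<in>fibre i. {#\<Sum>y\<in>fibre 0. psi (b * y)#}) = replicate_mset n (of_int (eta i))"
      by (simp add: const i)
  qed simp
  finally show ?thesis by (simp add: card_fibre)
qed

end

text \<open>\<open>y ^ n = 1\<close> has at most \<open>n\<close> roots, so some nonzero
  \<open>g\<close> yields a nontrivial fifth root of unity \<open>g ^ n\<close>, taken as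
  \<open>\<tau>\<close>.\<close>

lemma exists_quintic_field:
  assumes "prime p" "[p = 1] (mod 5)" "CARD('a::{field,finite}) = p ^ m" "5 dvd m" "m > 0" "n = (p ^ m - 1) div 5"
  shows "\<exists>(\<tau>::'a) T. quintic_field p m n \<tau> T"
proof -
  have p1: "p > 1" using assms(1) prime_gt_1_nat by blast
  have "[p ^ m = 1 ^ m] (mod 5)" using assms(2) by (rule cong_pow)
  then have "[p ^ m = 1] (mod 5)" by (simp only: power_one)
  then have "5 dvd p ^ m - 1" by (rule cong_to_1_nat)
  then have n: "5 * n = p ^ m - 1" using assms(6) by simp
  have q1: "p ^ m > 1" using p1 assms(5) by (rule one_less_power)
  then have n0: "n > 0" using n by (cases n) auto
  have "card {y::'a. y ^ n = 1} < card (UNIV - {0::'a})"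
    using card_power_eq_le(2)[OF n0, of "1::'a"] n n0 by (simp add: card_Diff_singleton assms(3))
  then have "\<not> UNIV - {0} \<subseteq> {y::'a. y ^ n = 1}"
    using card_mono[of "{y::'a. y ^ n = 1}" "UNIV - {0}"] by auto
  then obtain g :: 'a where g: "g \<noteq> 0" "g ^ n \<noteq> 1" by auto
  have "(g ^ n) ^ 5 = 1"
    using finite_field_power_card_minus_1[OF g(1)] n assms(3) by (simp add: mult.commute flip: power_mult)
  moreover obtain T :: "'a \<Rightarrow> nat" where "\<And>x. T x < p" "\<And>x y. [T (x + y) = T x + T y] (mod p)" "\<exists>x. T x \<noteq> 0"
    using exists_prime_functional[OF assms(3,1,5)] by blast
  ultimately have "quintic_field p m n (g ^ n) T"
    using assms n g by unfold_locales
  then show ?thesis by blast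
qed

theorem proposition3p4:
  fixes p q m s n :: nat and x w v u :: int
  assumes "prime p" and "[p = 1] (mod 5)"
    and "s \<ge> 1" and "m = 5 * s" and "q = p ^ m"
    and "CARD('a::{field,finite}) = q"
    and "n = (q - 1) div 5"
    and "16 * int p ^ s = x^2 + 125 * w^2 + 50 * v^2 + 50 * u^2"
    and "x * w = v^2 - 4 * u * v - u^2"
    and "[x = -1] (mod 5)"
    and "\<not> int p dvd x^2 - 125 * w^2"
  shows "Spec (gen_paley 5 :: 'a pair_pre_digraph) =
    {# of_nat n #} + (\<Sum>i<5. replicate_mset n ((eta_star p s (x, w, v, u) i - 1) / 5))"
proof -
  have sol: "quintic_solution (int p ^ s) x w v u" using assms(8,9) by unfold_locales
  interpret S: quintic_solution "int p ^ s" x w v u by fact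
  have "CARD('a) = p ^ m" "5 dvd m" "m > 0" "n = (p ^ m - 1) div 5" using assms(3-7) by auto
  from exists_quintic_field[OF assms(1,2) this] obtain \<tau> :: 'a and T where "quintic_field p m n \<tau> T"
    by blast
  then interpret F: quintic_field p m n \<tau> T .
  define H where "H = (\<lambda>c. - (of_nat p ^ s / 64) * (5 * of_int (S.h c) - of_int x ^ 3 :: complex))"
  from F.eta_eq_solution[OF sol assms(4,10,11)] obtain f where f: "bij_betw f {..<5} {..<5}"
    and eta: "\<And>i. i < 5 \<Longrightarrow> 5 * of_int (F.eta i) + 1 = H (f i)" unfolding H_def by blast
  have "(\<Sum>i<5. replicate_mset n (of_int (F.eta i))) = (\<Sum>i<5. replicate_mset n ((H (f i) - 1) / 5))"
    by (rule sum.cong) (simp_all flip: eta)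
  \<comment> \<open>The multiset does not see the unknown permutation \<open>f\<close>.\<close>
  also have "\<dots> = (\<Sum>c<5. replicate_mset n ((H c - 1) / 5))"
    by (rule sum.reindex_bij_betw[OF f])
  also have "\<dots> = (\<Sum>i<5. replicate_mset n ((eta_star p s (x, w, v, u) i - 1) / 5))"
  proof -
    \<comment> \<open>The iterates of \<open>quintic_sigma\<close> belong to the exponents 2, 1, 3,
      4, each being 3 times the preceding one modulo 5.\<close>
    have "eta_star p s (x, w, v, u) 0 = H 0" "eta_star p s (x, w, v, u) 1 = H 2"
      "eta_star p s (x, w, v, u) 2 = H 1" "eta_star p s (x, w, v, u) 3 = H 3"
      "eta_star p s (x, w, v, u) 4 = H 4"
      by (simp_all add: H_def S.h_def quintic_sigma_def numeral_2_eq_2 numeral_3_eq_3 field_simps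
        eval_nat_numeral)
    then show ?thesis by (simp add: eval_nat_numeral add_ac)
  qed
  finally show ?thesis unfolding F.Spec_gen_paley by simp
qed

end
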